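(* Let $f$ be a positive function in $L^1_{loc}(\mathbb{R}_+)$ and define $F(z)=\int_0^z f(|y|)\,dy$. Let $q:[0,T]\to\mathbb{R}$ be an absolutely continuous strategy, let $v_t=-q'(t)$, and let the stock price $S$ have the dynamics $$dS_t=\sigma\,dW_t-f(|q_0-q_t|)\,v_t\,dt ,$$ with no trading after time $T$ (that is, $v_t=0$ for $t>T$). If $q(0)=q_0$ and $q(T)=0$, then for all $T'\ge T$, $$S_{T'}-S_0=-F(q_0)+\sigma W_{T'}.$$
   Context: All processes are defined on a filtered probability space $(\Omega,\mathcal{F},(\mathcal{F}_t)_{t\in\mathbb{R}_+},\mathbb{P})$ satisfying the usual conditions. $T>0$ is the end of the trading window $[0,T]$, $W$ is a standard Brownian motion started at $0$, and $\sigma$ is a constant. The function $q$ (with $q_t=q(t)$) gives the number of shares held by a trader at time $t$, so $v_t$ is the trading (selling) speed; $S_t$ is the stock price, and the drift term $-f(|q_0-q_t|)v_t$ models permanent market impact, which depends on the quantity $|q_0-q_t|$ executed so far. *)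

theory Defs
  imports "HOL-Probability.Probability"
begin

section \<open>Function classes on the real line\<close>

definition locally_integrable_on :: "(real \<Rightarrow> real) \<Rightarrow> real set \<Rightarrow> bool" where
  "locally_integrable_on f A \<longleftrightarrow> (\<forall>K. compact K \<and> K \<subseteq> A \<longrightarrow> set_integrable lebesgue K f)"

text \<open>A pair \<open>(x, y) \<in> D\<close> stands for the interval from \<open>x\<close> to \<open>y\<close>.\<close>

definition absolutely_continuous_fun_on :: "real \<Rightarrow> real \<Rightarrow> (real \<Rightarrow> real) \<Rightarrow> bool" where
  "absolutely_continuous_fun_on a b q \<longleftrightarrow>
     (\<forall>\<epsilon>>0. \<exists>\<delta>>0. \<forall>D :: (real \<times> real) set.
        finite D \<and> (\<forall>(x, y)\<in>D. a \<le> x \<and> x < y \<and> y \<le> b) \<and>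
        disjoint_family_on (\<lambda>(x, y). {x<..<y}) D \<and> (\<Sum>(x, y)\<in>D. y - x) < \<delta>
        \<longrightarrow> (\<Sum>(x, y)\<in>D. \<bar>q y - q x\<bar>) < \<epsilon>)"

section \<open>Filtered probability spaces and Brownian motion\<close>

text \<open>The time set is \<open>{0..}\<close>; the values \<open>\<F> t\<close> (and those of all processes below) at
  negative times are irrelevant.\<close>

locale usual_filtered_prob_space = prob_space M + complete_measure M
  for M :: "'a measure" +
  fixes \<F> :: "real \<Rightarrow> 'a measure"
  assumes subalgebra: "0 \<le> t \<Longrightarrow> subalgebra M (\<F> t)"
    and mono: "0 \<le> s \<Longrightarrow> s \<le> t \<Longrightarrow> sets (\<F> s) \<subseteq> sets (\<F> t)"
    and null_sets_initial: "null_sets M \<subseteq> sets (\<F> 0)"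
    and right_continuous: "0 \<le> t \<Longrightarrow> (\<Inter>u\<in>{t<..}. sets (\<F> u)) \<subseteq> sets (\<F> t)"

definition adapted_process :: "(real \<Rightarrow> 'a measure) \<Rightarrow> (real \<Rightarrow> 'a \<Rightarrow> real) \<Rightarrow> bool" where
  "adapted_process \<F> X \<longleftrightarrow> (\<forall>t\<ge>0. X t \<in> borel_measurable (\<F> t))"

text \<open>\<open>normal_density\<close> takes the standard deviation, not the variance.\<close>

definition standard_brownian_motion ::
  "'a measure \<Rightarrow> (real \<Rightarrow> 'a measure) \<Rightarrow> (real \<Rightarrow> 'a \<Rightarrow> real) \<Rightarrow> bool" where
  "standard_brownian_motion M \<F> W \<longleftrightarrow>
     adapted_process \<F> W \<and>
     (AE \<omega> in M. W 0 \<omega> = 0) \<and>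
     (AE \<omega> in M. continuous_on {0..} (\<lambda>t. W t \<omega>)) \<and>
     (\<forall>s t. 0 \<le> s \<and> s < t \<longrightarrow>
        distributed M lborel (\<lambda>\<omega>. W t \<omega> - W s \<omega>) (normal_density 0 (sqrt (t - s))) \<and>
        prob_space.indep_set M (sets (\<F> s))
          (sets (vimage_algebra (space M) (\<lambda>\<omega>. W t \<omega> - W s \<omega>) borel)))"

section \<open>Price dynamics and cumulated impact\<close>

text \<open>\<open>dS = \<sigma> dW + b dt\<close> with constant \<open>\<sigma>\<close> and deterministic drift \<open>b\<close>. The stochastic integral
  of the constant integrand \<open>\<sigma>\<close> over \<open>[0, t]\<close> is \<open>\<sigma> (W t - W 0)\<close>, and the drift has to be
  integrable on bounded time intervals for the differential to be meaningful. As usual, the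
  integrated equation holds for all times outside of one single null set.\<close>

definition has_stochastic_differential ::
  "'a measure \<Rightarrow> (real \<Rightarrow> 'a measure) \<Rightarrow> (real \<Rightarrow> 'a \<Rightarrow> real) \<Rightarrow> real \<Rightarrow> (real \<Rightarrow> 'a \<Rightarrow> real)
    \<Rightarrow> (real \<Rightarrow> real) \<Rightarrow> bool" where
  "has_stochastic_differential M \<F> S \<sigma> W b \<longleftrightarrow>
     adapted_process \<F> S \<and>
     (\<forall>t\<ge>0. set_integrable lebesgue {0..t} b) \<and>
     (AE \<omega> in M. \<forall>t\<ge>0. S t \<omega> = S 0 \<omega> + \<sigma> * (W t \<omega> - W 0 \<omega>) + (LINT s:{0..t}|lebesgue. b s))"

text \<open>The integral is oriented, as \<open>z\<close> may be negative.\<close>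

definition cumulated_impact :: "(real \<Rightarrow> real) \<Rightarrow> real \<Rightarrow> real" where
  "cumulated_impact f z = (LINT y=0..z|lebesgue. f \<bar>y\<bar>)"

end

theory Submission
  imports Defs
begin

text \<open>With \<open>u t = q0 - q t\<close> the drift equals \<open>- f \<bar>u t\<bar> * u' t\<close> almost everywhere on \<open>{0..T}\<close> and vanishes
  afterwards, so the claim is the substitution rule for \<open>u\<close>, which runs from \<open>0\<close> to \<open>q0\<close>. Here \<open>f\<close> is only
  locally integrable and \<open>u\<close> only absolutely continuous. Functions of bounded variation are
  differentiable almost everywhere (Vitali covering and Austin's argument), and absolutely
  continuous ones are integrals of their derivative. For continuous \<open>f\<close> the rule is then the chain
  rule; bounded measurable \<open>f\<close> are almost everywhere limits of continuous functions, where the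
  exceptional null set is harmless since \<open>u'\<close> vanishes almost everywhere on its preimage; and
  truncation removes the boundedness, dominated by the drift, which is integrable by hypothesis.\<close>

section \<open>Functions of bounded variation\<close>

text \<open>The obstacle is that the cumulated impact along \<open>u\<close> need not be absolutely
  continuous. For \<open>f y = 1 / (2 * sqrt y)\<close> and
  \<open>u t = t^2 * (sin (1 / t))^2\<close> it equals \<open>t * |sin (1 / t)|\<close>, which has
  infinite variation near \<open>0\<close>. The chain rule is therefore applied only to primitives
  of continuous functions, which are Lipschitz on the range of \<open>u\<close>; everything after
  that is a limit of integrals, and the integrability of the drift takes the place of the missing
  absolute continuity. All estimates run over finite families of nonoverlapping intervals.
  \<open>interval_family\<close> repeats the conditions on \<open>D\<close> in
  \<open>absolutely_continuous_fun_on\<close>, so that the same families express absolute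
  continuity, variation, the finite parts of a Vitali cover and the pieces of a gauge division. The
  derivative is integrated in the gauge sense: the gauge can treat tags in the null set of bad
  points separately, and measurability of the derivative is not an issue at that stage. Absolute
  integrability is then deduced from bounded variation.\<close>

definition interval_family :: "real \<Rightarrow> real \<Rightarrow> (real \<times> real) set \<Rightarrow> bool" where
  "interval_family a b D \<longleftrightarrow> finite D \<and> (\<forall>(x, y)\<in>D. a \<le> x \<and> x < y \<and> y \<le> b) \<and>
     disjoint_family_on (\<lambda>(x, y). {x<..<y}) D"

lemma disjoint_open_intervals_iff:
  fixes x y x' y' :: real
  assumes "x < y" "x' < y'"
  shows "{x<..<y} \<inter> {x'<..<y'} = {} \<longleftrightarrow> y \<le> x' \<or> y' \<le> x"
proof
  assume empty: "{x<..<y} \<inter> {x'<..<y'} = {}"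
  show "y \<le> x' \<or> y' \<le> x"
  proof (rule ccontr)
    assume "\<not> (y \<le> x' \<or> y' \<le> x)"
    with assms have "max x x' < min y y'" by auto
    then obtain z where "max x x' < z" "z < min y y'" using dense by blast
    then have "z \<in> {x<..<y} \<inter> {x'<..<y'}" by auto
    with empty show False by blast
  qed
qed auto

lemma interval_family_iff:
  "interval_family a b D \<longleftrightarrow> finite D \<and> (\<forall>(x, y)\<in>D. a \<le> x \<and> x < y \<and> y \<le> b) \<and>
     (\<forall>(x, y)\<in>D. \<forall>(x', y')\<in>D. (x, y) \<noteq> (x', y') \<longrightarrow> y \<le> x' \<or> y' \<le> x)"
proof -
  have "disjoint_family_on (\<lambda>(x, y). {x<..<y}) D \<longleftrightarrow>
      (\<forall>(x, y)\<in>D. \<forall>(x', y')\<in>D. (x, y) \<noteq> (x', y') \<longrightarrow> y \<le> x' \<or> y' \<le> x)"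
    if "\<forall>(x, y)\<in>D. a \<le> x \<and> x < y \<and> y \<le> b"
    unfolding disjoint_family_on_def split_beta
  proof (intro ball_cong refl)
    fix p p' assume "p \<in> D" "p' \<in> D"
    with that show "(p \<noteq> p' \<longrightarrow> {fst p<..<snd p} \<inter> {fst p'<..<snd p'} = {}) \<longleftrightarrow>
        ((fst p, snd p) \<noteq> (fst p', snd p') \<longrightarrow> snd p \<le> fst p' \<or> snd p' \<le> fst p)"
      using disjoint_open_intervals_iff[of "fst p" "snd p" "fst p'" "snd p'"]
      by (auto simp: split_beta prod_eq_iff)
  qed
  then show ?thesis
    unfolding interval_family_def by blast
qed

lemma interval_familyI:
  assumes "finite D" "\<And>x y. (x, y) \<in> D \<Longrightarrow> a \<le> x \<and> x < y \<and> y \<le> b"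
    and "\<And>x y x' y'. \<lbrakk>(x, y) \<in> D; (x', y') \<in> D; (x, y) \<noteq> (x', y')\<rbrakk> \<Longrightarrow> y \<le> x' \<or> y' \<le> x"
  shows "interval_family a b D"
  using assms unfolding interval_family_iff by blast

lemma interval_familyD:
  assumes "interval_family a b D"
  shows "finite D" "(x, y) \<in> D \<Longrightarrow> a \<le> x" "(x, y) \<in> D \<Longrightarrow> x < y" "(x, y) \<in> D \<Longrightarrow> y \<le> b"
    and "\<lbrakk>(x, y) \<in> D; (x', y') \<in> D; (x, y) \<noteq> (x', y')\<rbrakk> \<Longrightarrow> y \<le> x' \<or> y' \<le> x"
  using assms unfolding interval_family_iff by blast+

lemma interval_family_empty [simp]: "interval_family a b {}"
  by (simp add: interval_family_iff)

lemma interval_family_mono: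
  assumes "interval_family a b D" "a' \<le> a" "b \<le> b'"
  shows "interval_family a' b' D"
  using assms unfolding interval_family_iff by fastforce

text \<open>Filling the gaps between the intervals with nonnegative increments of \<open>V\<close>
  makes the sum telescope. The induction removes the interval with the largest left endpoint
  \<open>x\<close>; the others lie in \<open>{a..x}\<close>, which is why \<open>b\<close> is
  generalized.\<close>

lemma sum_increments_le:
  assumes "interval_family a b D" "a \<le> b"
    and "\<And>x y. \<lbrakk>a \<le> x; x \<le> y; y \<le> b\<rbrakk> \<Longrightarrow> (V x :: real) \<le> V y"
  shows "(\<Sum>(x, y)\<in>D. V y - V x) \<le> V b - V a"
  using assms
proof (induction "card D" arbitrary: b D)
  case 0
  then have "D = {}" by (auto simp: interval_family_def)
  with 0 show ?case by simp
next
  case (Suc n)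
  note D = interval_familyD[OF Suc.prems(1)]
  have "D \<noteq> {}" using Suc.hyps by auto
  then have "Max (fst ` D) \<in> fst ` D" using D(1) by simp
  then obtain x y where xy: "(x, y) \<in> D" "x = Max (fst ` D)" by auto
  have xmax: "x' \<le> x" if "(x', y') \<in> D" for x' y'
    unfolding xy(2) using that D(1) by (intro Max_ge) (auto simp: image_iff intro: bexI[of _ "(x', y')"])
  have le: "y' \<le> x" if "(x', y') \<in> D - {(x, y)}" for x' y'
    using D(5)[of x' y' x y] D(3)[OF xy(1)] xmax[of x' y'] xy(1) that by auto
  have "n = card (D - {(x, y)})"
    using Suc.hyps(2) xy D(1) by simp
  moreover have "interval_family a x (D - {(x, y)})"
    by (rule interval_familyI) (use D le in auto)
  ultimately have "(\<Sum>(x, y)\<in>D - {(x, y)}. V y - V x) \<le> V x - V a"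
  proof (rule Suc.hyps(1))
    show "a \<le> x" using D(2)[OF xy(1)] .
    show "V s \<le> V t" if "a \<le> s" "s \<le> t" "t \<le> x" for s t
      using Suc.prems(3)[of s t] that D(3,4)[OF xy(1)] by simp
  qed
  moreover have "V y \<le> V b"
    using Suc.prems(3) D(2,3,4)[OF xy(1)] by simp
  ultimately show ?case
    using xy D(1) by (simp add: sum.remove)
qed

text \<open>A majorant is used instead of the total variation itself, because restricting, gluing
  and adding a linear term then have explicit majorants. The condition forces \<open>V\<close> to be
  nondecreasing on \<open>{a..b}\<close>.\<close>

definition variation_bound :: "real \<Rightarrow> real \<Rightarrow> (real \<Rightarrow> real) \<Rightarrow> (real \<Rightarrow> real) \<Rightarrow> bool" where
  "variation_bound a b u V \<longleftrightarrow> (\<forall>x y. a \<le> x \<and> x \<le> y \<and> y \<le> b \<longrightarrow> \<bar>u y - u x\<bar> \<le> V y - V x)"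

lemma variation_boundD:
  assumes "variation_bound a b u V" "a \<le> x" "x \<le> y" "y \<le> b"
  shows "\<bar>u y - u x\<bar> \<le> V y - V x" "V x \<le> V y"
  using assms unfolding variation_bound_def by force+

text \<open>The witness is the total variation function, the supremum of the sums over families in
  \<open>{a..t}\<close>; appending \<open>(x, y)\<close> to a family in \<open>{a..x}\<close> gives
  the majorant property. The second conclusion, that \<open>V b - V a\<close> is nearly attained, is
  what Austin's argument feeds on.\<close>

lemma variation_bound_of_sums:
  assumes "a \<le> b"
    and B: "\<And>D. interval_family a b D \<Longrightarrow> (\<Sum>(x, y)\<in>D. \<bar>u y - u x\<bar>) \<le> B"
  obtains V where "variation_bound a b u V"
    and "\<And>\<epsilon>. 0 < \<epsilon> \<Longrightarrow> \<exists>D. interval_family a b D \<and> V b - V a - \<epsilon> < (\<Sum>(x, y)\<in>D. \<bar>u y - u x\<bar>)"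
proof -
  define A where "A t = (\<lambda>D. \<Sum>(x, y)\<in>D. \<bar>u y - u x\<bar>) ` {D. interval_family a t D}" for t
  define V where "V t = Sup (A t)" for t
  have bdd: "bdd_above (A t)" if "t \<le> b" for t
    unfolding A_def using B interval_family_mono[OF _ order_refl that] by (intro bdd_aboveI2) blast
  have ne: "A t \<noteq> {}" for t
    using interval_family_empty unfolding A_def by blast
  have "\<bar>u y - u x\<bar> \<le> V y - V x" if xy: "a \<le> x" "x \<le> y" "y \<le> b" for x y
  proof (cases "x = y")
    case False
    have "V x \<le> V y - \<bar>u y - u x\<bar>"
      unfolding V_def
    proof (rule cSup_least[OF ne])
      fix s assume "s \<in> A x"
      then obtain D where D: "interval_family a x D" and s: "s = (\<Sum>(x, y)\<in>D. \<bar>u y - u x\<bar>)"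
        by (auto simp: A_def)
      have "(x, y) \<notin> D"
        using interval_familyD(3,4)[OF D] False xy by force
      then have "s + \<bar>u y - u x\<bar> = (\<Sum>(x, y)\<in>insert (x, y) D. \<bar>u y - u x\<bar>)"
        using s interval_familyD(1)[OF D] by simp
      moreover have "interval_family a y (insert (x, y) D)"
      proof (rule interval_familyI)
        fix p r p' r' assume "(p, r) \<in> insert (x, y) D" "(p', r') \<in> insert (x, y) D" "(p, r) \<noteq> (p', r')"
        then show "r \<le> p' \<or> r' \<le> p"
          using interval_familyD(4)[OF D, of p r] interval_familyD(4)[OF D, of p' r']
            interval_familyD(5)[OF D, of p r p' r'] by auto
      next
        fix p r assume "(p, r) \<in> insert (x, y) D"
        then show "a \<le> p \<and> p < r \<and> r \<le> y"
          using interval_familyD(2-4)[OF D, of p r] False xy by auto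
      qed (use interval_familyD(1)[OF D] in simp)
      ultimately have "s + \<bar>u y - u x\<bar> \<in> A y"
        unfolding A_def by blast
      then show "s \<le> Sup (A y) - \<bar>u y - u x\<bar>"
        using cSup_upper[OF _ bdd[OF xy(3)]] by fastforce
    qed
    then show ?thesis by simp
  qed simp
  then have "variation_bound a b u V"
    by (simp add: variation_bound_def)
  moreover have "\<exists>D. interval_family a b D \<and> V b - V a - \<epsilon> < (\<Sum>(x, y)\<in>D. \<bar>u y - u x\<bar>)"
    if "0 < \<epsilon>" for \<epsilon>
  proof -
    have "V b - \<epsilon> < Sup (A b)"
      using that by (simp add: V_def)
    then obtain s where "s \<in> A b" "V b - \<epsilon> < s"
      using less_cSup_iff[OF ne bdd] by auto
    \<comment> \<open>The empty family contributes the sum \<open>0\<close>; hence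
      \<open>V b - V a\<close> is at most the supremum \<open>V b\<close>, which the chosen family
      nearly reaches.\<close>
    moreover have "0 \<le> V a"
    proof -
      have "0 \<in> A a"
        unfolding A_def using interval_family_empty by (intro image_eqI[of _ _ "{}"]) auto
      then show ?thesis
        unfolding V_def using bdd[OF \<open>a \<le> b\<close>] by (rule cSup_upper)
    qed
    ultimately show ?thesis
      unfolding A_def by (auto simp: algebra_simps intro: less_le_trans)
  qed
  ultimately show ?thesis using that by blast
qed

lemma variation_bound_sum_le:
  assumes "interval_family a b D" "a \<le> b" "variation_bound a b u V"
  shows "(\<Sum>(x, y)\<in>D. \<bar>u y - u x\<bar>) \<le> V b - V a"
proof -
  have "(\<Sum>(x, y)\<in>D. \<bar>u y - u x\<bar>) \<le> (\<Sum>(x, y)\<in>D. V y - V x)"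
    using variation_boundD(1)[OF assms(3)] interval_familyD(2,4)[OF assms(1)]
      interval_familyD(3)[OF assms(1), THEN less_imp_le]
    by (intro sum_mono) auto
  also have "\<dots> \<le> V b - V a"
    using sum_increments_le[OF assms(1,2)] variation_boundD(2)[OF assms(3)] by simp
  finally show ?thesis .
qed

lemma variation_bound_combine:
  assumes "variation_bound a b u V" "variation_bound b c u V'" "a \<le> b" "b \<le> c"
  shows "variation_bound a c u (\<lambda>t. if t \<le> b then V t else V b + (V' t - V' b))"
  unfolding variation_bound_def
proof (intro allI impI)
  fix x y assume xy: "a \<le> x \<and> x \<le> y \<and> y \<le> c"
  then show "\<bar>u y - u x\<bar> \<le> (if y \<le> b then V y else V b + (V' y - V' b)) -
      (if x \<le> b then V x else V b + (V' x - V' b))"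
    using variation_boundD(1)[OF assms(1), of x b] variation_boundD(1)[OF assms(2), of b y]
      variation_boundD(1)[OF assms(1), of x y] variation_boundD(1)[OF assms(2), of x y] by auto
qed

text \<open>Vitali covering, with the disjoint subfamily reduced to its finite parts.\<close>

lemma negligible_if_fine_covers:
  assumes cover: "\<And>\<epsilon>. 0 < \<epsilon> \<Longrightarrow> \<exists>K N. negligible N \<and> (\<forall>(x, y)\<in>K. a \<le> x \<and> x < y \<and> y \<le> b) \<and>
      (\<forall>t\<in>S - N. \<forall>d>0. \<exists>(x, y)\<in>K. x \<le> t \<and> t \<le> y \<and> y - x < d) \<and>
      (\<forall>D\<subseteq>K. interval_family a b D \<longrightarrow> (\<Sum>(x, y)\<in>D. y - x) \<le> \<epsilon>)"
  shows "negligible S"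
  unfolding negligible_outer_le
proof (intro allI impI)
  fix \<epsilon> :: real assume "0 < \<epsilon>"
  from cover[OF this] obtain K N where N: "negligible N"
    and K0: "\<forall>(x, y)\<in>K. a \<le> x \<and> x < y \<and> y \<le> b"
    and fine: "\<forall>t\<in>S - N. \<forall>d>0. \<exists>(x, y)\<in>K. x \<le> t \<and> t \<le> y \<and> y - x < d"
    and small: "\<forall>D\<subseteq>K. interval_family a b D \<longrightarrow> (\<Sum>(x, y)\<in>D. y - x) \<le> \<epsilon>"
    by (elim exE conjE)
  have K: "a \<le> x \<and> x < y \<and> y \<le> b" if "(x, y) \<in> K" for x y
    using K0 that by blast
  \<comment> \<open>Midpoint and radius, so that the intervals of \<open>K\<close> become the closed
    balls of the covering theorem.\<close>
  define m :: "real \<times> real \<Rightarrow> real" where "m = (\<lambda>(x, y). (x + y) / 2)"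
  define r :: "real \<times> real \<Rightarrow> real" where "r = (\<lambda>(x, y). (y - x) / 2)"
  have cball: "cball (m i) (r i) = {fst i..snd i}" for i
    by (auto simp: m_def r_def cball_eq_atLeastAtMost split_beta field_simps)
  obtain C where C: "countable C" "C \<subseteq> K"
    "pairwise (\<lambda>i j. disjnt (cball (m i) (r i)) (cball (m j) (r j))) C"
    "negligible ((S - N) - (\<Union>i\<in>C. cball (m i) (r i)))"
  proof (rule Vitali_covering_theorem_cballs[of K r "S - N" m])
    show "0 < r i" if "i \<in> K" for i
      using K[of "fst i" "snd i"] that by (auto simp: r_def split_beta)
    show "\<exists>i. i \<in> K \<and> t \<in> cball (m i) (r i) \<and> r i < d" if t: "t \<in> S - N" "0 < d" for t d
    proof -
      obtain x y where "(x, y) \<in> K" "x \<le> t" "t \<le> y" "y - x < d"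
        using fine t by blast
      moreover have "r (x, y) < d"
        using calculation K[of x y] by (simp add: r_def)
      ultimately show ?thesis
        unfolding cball by (intro exI[of _ "(x, y)"]) auto
    qed
  qed
  let ?U = "\<Union>i\<in>C. {fst i..snd i}"
  have disj: "disjoint_family_on (\<lambda>i. {fst i..snd i}) C"
    using C(3) unfolding cball pairwise_def disjnt_def disjoint_family_on_def by blast
  have bound: "measure lebesgue (\<Union>i\<in>I. {fst i..snd i}) \<le> \<epsilon>" if I: "I \<subseteq> C" "finite I" for I
  proof -
    have "interval_family a b I"
    proof (rule interval_familyI)
      fix x y x' y' assume *: "(x, y) \<in> I" "(x', y') \<in> I" "(x, y) \<noteq> (x', y')"
      then have "{x..y} \<inter> {x'..y'} = {}"
        using disjoint_family_onD[OF disj, of "(x, y)" "(x', y')"] I by auto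
      moreover have "{x<..<y} \<inter> {x'<..<y'} \<subseteq> {x..y} \<inter> {x'..y'}"
        by auto
      moreover have "x < y" "x' < y'"
        using K * I C(2) by blast+
      ultimately show "y \<le> x' \<or> y' \<le> x"
        using disjoint_open_intervals_iff[of x y x' y'] by simp
    qed (use K I C(2) in blast)+
    then have "(\<Sum>(x, y)\<in>I. y - x) \<le> \<epsilon>"
      using small I(1) C(2) by auto
    moreover have "measure lebesgue (\<Union>i\<in>I. {fst i..snd i}) \<le> (\<Sum>i\<in>I. measure lebesgue {fst i..snd i})"
      using I by (intro measure_UNION_le) auto
    moreover have "(\<Sum>i\<in>I. measure lebesgue {fst i..snd i}) = (\<Sum>(x, y)\<in>I. y - x)"
    proof (intro sum.cong refl)
      fix i assume "i \<in> I"
      then have "fst i < snd i"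
        using K[of "fst i" "snd i"] I C(2) by auto
      then show "measure lebesgue {fst i..snd i} = (case i of (x, y) \<Rightarrow> y - x)"
        by (simp add: split_beta)
    qed
    ultimately show ?thesis by linarith
  qed
  have U: "?U \<in> lmeasurable" "measure lebesgue ?U \<le> \<epsilon>"
  proof -
    \<comment> \<open>The measure of a countable union is controlled by its finite subunions, and
      these are unions of interval families, for which the bound is assumed.\<close>
    have *: "measure lebesgue (\<Union>\<D>) \<le> \<epsilon>"
      if \<D>: "\<D> \<subseteq> (\<lambda>i. {fst i..snd i}) ` C" "finite \<D>" for \<D>
    proof -
      obtain I where "I \<subseteq> C" "finite I" "\<D> = (\<lambda>i. {fst i..snd i}) ` I"
        using finite_subset_image[OF \<D>(2,1)] by blast
      then show ?thesis using bound by simp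
    qed
    have "countable ((\<lambda>i. {fst i..snd i}) ` C)" using C(1) by simp
    then show "?U \<in> lmeasurable" "measure lebesgue ?U \<le> \<epsilon>"
      using fmeasurable_Union_bound[of "(\<lambda>i. {fst i..snd i}) ` C" lebesgue \<epsilon>]
        measure_Union_bound[of "(\<lambda>i. {fst i..snd i}) ` C" lebesgue \<epsilon>] *
      by auto
  qed
  let ?N = "N \<union> ((S - N) - ?U)"
  have neg: "negligible ?N" using N C(4) unfolding cball by simp
  have "S \<subseteq> ?U \<union> ?N" by blast
  moreover have "?U \<union> ?N \<in> lmeasurable"
    using U(1) negligible_imp_measurable[OF neg] by (rule fmeasurable.Un)
  moreover have "measure lebesgue (?U \<union> ?N) \<le> \<epsilon>"
    using measure_Un_le[of ?U lebesgue ?N] U neg negligible_imp_measure0[OF neg]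
      negligible_imp_sets[OF neg] by auto
  ultimately show "\<exists>T. S \<subseteq> T \<and> T \<in> lmeasurable \<and> measure lebesgue T \<le> \<epsilon>" by blast
qed

section \<open>Almost everywhere differentiability\<close>

text \<open>Austin's argument. Take a family \<open>D\<close> that nearly exhausts the variation of \<open>u\<close>. Inside an
  interval of \<open>D\<close> an increment of \<open>u\<close> against the overall one adds to the variation, as does
  every increment outside \<open>D\<close>, so the intervals with such an increment have small total length.\<close>

lemma negligible_opposite_slopes:
  assumes "a \<le> b" "0 < c" "variation_bound a b u V0" "S \<subseteq> {a<..<b}"
    and up: "\<And>t d. \<lbrakk>t \<in> S; 0 < d\<rbrakk> \<Longrightarrow>
      \<exists>x y. x < y \<and> x \<le> t \<and> t \<le> y \<and> y - x < d \<and> c * (y - x) \<le> u y - u x"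
    and down: "\<And>t d. \<lbrakk>t \<in> S; 0 < d\<rbrakk> \<Longrightarrow>
      \<exists>x y. x < y \<and> x \<le> t \<and> t \<le> y \<and> y - x < d \<and> u y - u x \<le> - c * (y - x)"
  shows "negligible S"
proof -
  obtain V where V: "variation_bound a b u V"
    and sharp: "\<And>\<epsilon>. 0 < \<epsilon> \<Longrightarrow> \<exists>D. interval_family a b D \<and> V b - V a - \<epsilon> < (\<Sum>(x, y)\<in>D. \<bar>u y - u x\<bar>)"
    using variation_bound_of_sums[OF \<open>a \<le> b\<close> variation_bound_sum_le[OF _ \<open>a \<le> b\<close> assms(3)]] by blast
  show ?thesis
  proof (rule negligible_if_fine_covers[where S = S and a = a and b = b])
    fix \<epsilon> :: real assume "0 < \<epsilon>"
    \<comment> \<open>The tolerance is \<open>c * \<epsilon>\<close> because the argument bounds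
      \<open>c\<close> times a total length.\<close>
    then obtain D where D: "interval_family a b D" and D_sharp: "V b - V a - c * \<epsilon> < (\<Sum>(x, y)\<in>D. \<bar>u y - u x\<bar>)"
      using sharp[of "c * \<epsilon>"] \<open>0 < c\<close> by auto
    \<comment> \<open>Covering intervals avoid the endpoints of \<open>D\<close>, so each of them
      lies strictly inside one interval of \<open>D\<close> or is disjoint from all of them. Only
      finitely many points are given up.\<close>
    define N where "N = fst ` D \<union> snd ` D"
    have "finite N" using interval_familyD(1)[OF D] by (simp add: N_def)
    define host where "host x y p r \<longleftrightarrow> (p, r) \<in> D \<and> p < x \<and> y < r" for x y p r
    \<comment> \<open>The direction of the increment is chosen against the host: falling inside a
      host with \<open>u p \<le> u r\<close>, rising inside a falling host. Without a host either
      direction would serve, and rising is taken.\<close>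
    define K where "K = {(x, y). x < y \<and> {x..y} \<subseteq> {a<..<b} - N \<and>
      (if \<exists>p r. host x y p r \<and> u p \<le> u r then u y - u x \<le> - c * (y - x)
       else c * (y - x) \<le> u y - u x)}"
    have host_unique: "p = p' \<and> r = r'" if "host x y p r" "host x y p' r'" "x < y" for x y p r p' r'
      using interval_familyD(5)[OF D, of p r p' r'] that by (auto simp: host_def)
    have K: "a < x" "x < y" "y < b" if "(x, y) \<in> K" for x y
    proof -
      have *: "x < y" "{x..y} \<subseteq> {a<..<b} - N" using that by (auto simp: K_def)
      then show "a < x" "x < y" "y < b"
        using subsetD[OF *(2), of x] subsetD[OF *(2), of y] by auto
    qed
    have fine: "\<exists>(x, y)\<in>K. x \<le> t \<and> t \<le> y \<and> y - x < d" if t: "t \<in> S - N" "0 < d" for t d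
    proof -
      have "open ({a<..<b} - N)"
        using \<open>finite N\<close> by (intro open_Diff finite_imp_closed) auto
      then obtain e where e: "0 < e" "ball t e \<subseteq> {a<..<b} - N"
        using t \<open>S \<subseteq> _\<close> by (meson DiffD1 DiffD2 DiffI openE subsetD)
      have sub: "{x..y} \<subseteq> {a<..<b} - N" if "x \<le> t" "t \<le> y" "y - x < e" for x y
      proof -
        have "{x..y} \<subseteq> ball t e" using that by (auto simp: dist_real_def)
        then show ?thesis using e(2) by blast
      qed
      show ?thesis
      proof (cases "\<exists>(p, r)\<in>D. p < t \<and> t < r \<and> u p \<le> u r")
        case True
        then obtain p r where pr: "(p, r) \<in> D" "p < t" "t < r" "u p \<le> u r" by blast
        obtain x y where xy: "x < y" "x \<le> t" "t \<le> y" "y - x < Min {d, e, t - p, r - t}"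
            "u y - u x \<le> - c * (y - x)"
          using down[of t "Min {d, e, t - p, r - t}"] t e(1) pr by auto
        then have "host x y p r"
          using pr by (auto simp: host_def)
        then have "(x, y) \<in> K"
          using sub[of x y] xy pr(4) unfolding K_def by auto
        then show ?thesis using xy by auto
      next
        case False
        obtain x y where xy: "x < y" "x \<le> t" "t \<le> y" "y - x < Min {d, e}"
            "c * (y - x) \<le> u y - u x"
          using up[of t "Min {d, e}"] t e(1) by auto
        have "\<not> (\<exists>p r. host x y p r \<and> u p \<le> u r)"
          using False xy unfolding host_def by force
        then have "(x, y) \<in> K"
          using sub[of x y] xy unfolding K_def by auto
        then show ?thesis using xy by auto
      qed
    qed
    have small: "(\<Sum>(x, y)\<in>P. y - x) \<le> \<epsilon>" if P: "P \<subseteq> K" "interval_family a b P" for P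
    proof -
      note Pf = interval_familyD[OF P(2)]
      define H where "H = (\<lambda>(p, r). {(x, y)\<in>P. host x y p r})"
      define P0 where "P0 = P - (\<Union>i\<in>D. H i)"
      have H_sub: "H i \<subseteq> P" for i by (auto simp: H_def)
      have finH: "finite (H i)" for i using H_sub Pf(1) finite_subset by blast
      have out: "(\<Sum>(x, y)\<in>P0. c * (y - x)) \<le> (\<Sum>(x, y)\<in>P0. V y - V x)"
      proof (rule sum_mono, clarify)
        fix x y assume xy: "(x, y) \<in> P0"
        then have "(x, y) \<in> K" using P(1) by (auto simp: P0_def)
        moreover have "\<not> host x y p r" for p r
          using xy by (auto simp: P0_def H_def host_def)
        ultimately have "c * (y - x) \<le> u y - u x" by (auto simp: K_def)
        then show "c * (y - x) \<le> V y - V x"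
          using variation_boundD(1)[OF V, of x y] K[OF \<open>(x, y) \<in> K\<close>] by linarith
      qed
      have ins: "(\<Sum>(x, y)\<in>H (p, r). c * (y - x)) \<le> (V r - V p) - \<bar>u r - u p\<bar>" if pr: "(p, r) \<in> D" for p r
      proof -
        \<comment> \<open>With this sign, \<open>V - \<sigma> * u\<close> is nondecreasing, its
          increment over the host is exactly \<open>(V r - V p) - |u r - u p|\<close>, and each
          chosen interval contributes at least \<open>c\<close> times its length to it.\<close>
        define \<sigma> :: real where "\<sigma> = (if u p \<le> u r then 1 else -1)"
        note ab = interval_familyD(2-4)[OF D pr]
        have fam: "interval_family p r (H (p, r))"
        proof (rule interval_familyI)
          show "p \<le> x \<and> x < y \<and> y \<le> r" if "(x, y) \<in> H (p, r)" for x y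
            using that Pf(3) by (auto simp: H_def host_def)
          show "y \<le> x' \<or> y' \<le> x" if "(x, y) \<in> H (p, r)" "(x', y') \<in> H (p, r)" "(x, y) \<noteq> (x', y')"
            for x y x' y'
            using that H_sub Pf(5) by blast
        qed (rule finH)
        have "(\<Sum>(x, y)\<in>H (p, r). c * (y - x)) \<le> (\<Sum>(x, y)\<in>H (p, r). (V y - \<sigma> * u y) - (V x - \<sigma> * u x))"
        proof (rule sum_mono, clarify)
          fix x y assume "(x, y) \<in> H (p, r)"
          then have xy: "(x, y) \<in> K" "host x y p r" using P(1) by (auto simp: H_def)
          have "\<sigma> * (u y - u x) \<le> - c * (y - x)"
          proof (cases "u p \<le> u r")
            case True
            with xy(2) have "\<exists>p r. host x y p r \<and> u p \<le> u r" by blast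
            with xy(1) True show ?thesis by (simp add: K_def \<sigma>_def)
          next
            case False
            then have "\<not> (\<exists>p r. host x y p r \<and> u p \<le> u r)"
              using host_unique[OF _ xy(2) K(2)[OF xy(1)]] by blast
            with xy(1) have "c * (y - x) \<le> u y - u x" unfolding K_def by simp
            with False show ?thesis by (simp add: \<sigma>_def)
          qed
          moreover have "0 \<le> V y - V x"
            using variation_boundD(2)[OF V, of x y] K[OF xy(1)] by linarith
          ultimately show "c * (y - x) \<le> (V y - \<sigma> * u y) - (V x - \<sigma> * u x)"
            by (simp add: algebra_simps)
        qed
        also have "\<dots> \<le> (V r - \<sigma> * u r) - (V p - \<sigma> * u p)"
        proof (rule sum_increments_le[OF fam])
          show "V x - \<sigma> * u x \<le> V y - \<sigma> * u y" if "p \<le> x" "x \<le> y" "y \<le> r" for x y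
            using variation_boundD(1)[OF V, of x y] that ab by (auto simp: \<sigma>_def abs_le_iff)
        qed (use ab in simp)
        also have "\<dots> = (V r - V p) - \<bar>u r - u p\<bar>"
          by (auto simp: \<sigma>_def)
        finally show ?thesis .
      qed
      have D_P0: "D \<inter> P0 = {}"
      proof -
        have False if "(x, y) \<in> D" "(x, y) \<in> P0" for x y
        proof -
          have "x \<in> N" using that(1) by (force simp: N_def)
          moreover have "x < y" "{x..y} \<subseteq> {a<..<b} - N"
            using that(2) P(1) by (auto simp: P0_def K_def)
          ultimately show False using subsetD[of "{x..y}" "{a<..<b} - N" x] by simp
        qed
        then show ?thesis by fast
      qed
      \<comment> \<open>The hosted intervals have already been charged to their hosts, so only the
        unhosted ones are joined to \<open>D\<close>; their \<open>V\<close>-increments and those of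
        \<open>D\<close> together fit under \<open>V b - V a\<close>.\<close>
      have fam: "interval_family a b (D \<union> P0)"
      proof (rule interval_familyI)
        have cross: "r \<le> x \<or> y \<le> p" if "(p, r) \<in> D" "(x, y) \<in> P0" for p r x y
        proof -
          have "p \<in> N" "r \<in> N" using that(1) by (force simp: N_def)+
          moreover have "\<not> host x y p r" "(x, y) \<in> K"
            using that P(1) by (auto simp: P0_def H_def)
          then have "\<not> (p < x \<and> y < r)" "{x..y} \<subseteq> {a<..<b} - N"
            using that(1) by (auto simp: K_def host_def)
          ultimately have "p \<notin> {x..y}" "r \<notin> {x..y}" "\<not> (p < x \<and> y < r)"
            by blast+
          then show ?thesis using interval_familyD(3)[OF D that(1)] by auto
        qed
        show "y \<le> x' \<or> y' \<le> x" if "(x, y) \<in> D \<union> P0" "(x', y') \<in> D \<union> P0" "(x, y) \<noteq> (x', y')" for x y x' y'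
          using that cross[of x y x' y'] cross[of x' y' x y] interval_familyD(5)[OF D, of x y x' y']
            Pf(5)[of x y x' y'] by (auto simp: P0_def)
        show "a \<le> x \<and> x < y \<and> y \<le> b" if "(x, y) \<in> D \<union> P0" for x y
          using that interval_familyD(2-4)[OF D, of x y] Pf(2-4)[of x y] by (auto simp: P0_def)
      qed (use Pf(1) interval_familyD(1)[OF D] in \<open>simp add: P0_def\<close>)
      have "(\<Sum>(x, y)\<in>P. c * (y - x)) = (\<Sum>(x, y)\<in>P0. c * (y - x)) + (\<Sum>(x, y)\<in>(\<Union>i\<in>D. H i). c * (y - x))"
        unfolding P0_def using H_sub Pf(1) by (intro sum.subset_diff) auto
      also have "(\<Sum>(x, y)\<in>(\<Union>i\<in>D. H i). c * (y - x)) = (\<Sum>i\<in>D. \<Sum>(x, y)\<in>H i. c * (y - x))"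
      proof (rule sum.UNION_disjoint)
        show "\<forall>i\<in>D. \<forall>j\<in>D. i \<noteq> j \<longrightarrow> H i \<inter> H j = {}"
        proof (intro ballI impI equals0I)
          fix i j k assume "i \<noteq> j" "k \<in> H i \<inter> H j"
          then show False
            using host_unique[of "fst k" "snd k" "fst i" "snd i" "fst j" "snd j"] Pf(3)[of "fst k" "snd k"]
            by (auto simp: H_def split_beta prod_eq_iff)
        qed
      qed (use interval_familyD(1)[OF D] finH in auto)
      also have "(\<Sum>i\<in>D. \<Sum>(x, y)\<in>H i. c * (y - x)) \<le> (\<Sum>(p, r)\<in>D. (V r - V p) - \<bar>u r - u p\<bar>)"
        using ins by (intro sum_mono) auto
      also have "\<dots> = (\<Sum>(p, r)\<in>D. V r - V p) - (\<Sum>(p, r)\<in>D. \<bar>u r - u p\<bar>)"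
        by (simp add: sum_subtractf split_beta)
      finally have "(\<Sum>(x, y)\<in>P. c * (y - x)) \<le>
          (\<Sum>(x, y)\<in>P0. V y - V x) + (\<Sum>(p, r)\<in>D. V r - V p) - (\<Sum>(p, r)\<in>D. \<bar>u r - u p\<bar>)"
        using out by linarith
      moreover have "(\<Sum>(x, y)\<in>P0. V y - V x) + (\<Sum>(p, r)\<in>D. V r - V p) = (\<Sum>(x, y)\<in>D \<union> P0. V y - V x)"
        using D_P0 interval_familyD(1)[OF D] Pf(1) by (subst sum.union_disjoint) (auto simp: P0_def)
      moreover have "\<dots> \<le> V b - V a"
        using sum_increments_le[OF fam \<open>a \<le> b\<close>] variation_boundD(2)[OF V] by simp
      \<comment> \<open>What is left after the \<open>V\<close>-increments are bounded by
        \<open>V b - V a\<close> is the amount by which \<open>D\<close> misses the total variation,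
        and that is below \<open>c * \<epsilon>\<close>.\<close>
      ultimately have "(\<Sum>(x, y)\<in>P. c * (y - x)) \<le> c * \<epsilon>"
        using D_sharp by linarith
      moreover have "(\<Sum>(x, y)\<in>P. c * (y - x)) = c * (\<Sum>(x, y)\<in>P. y - x)"
        by (simp add: sum_distrib_left split_beta)
      ultimately show ?thesis using \<open>0 < c\<close> by simp
    qed
    show "\<exists>K N. negligible N \<and> (\<forall>(x, y)\<in>K. a \<le> x \<and> x < y \<and> y \<le> b) \<and>
        (\<forall>t\<in>S - N. \<forall>d>0. \<exists>(x, y)\<in>K. x \<le> t \<and> t \<le> y \<and> y - x < d) \<and>
        (\<forall>D\<subseteq>K. interval_family a b D \<longrightarrow> (\<Sum>(x, y)\<in>D. y - x) \<le> \<epsilon>)"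
    proof (intro exI conjI)
      show "negligible N" using \<open>finite N\<close> by (rule negligible_finite)
      show "\<forall>(x, y)\<in>K. a \<le> x \<and> x < y \<and> y \<le> b" using K by (auto simp: less_imp_le)
    qed (use fine small in blast)+
  qed
qed

text \<open>Disjoint intervals of slope at least \<open>M\<close> in absolute value use up variation
  at rate \<open>M\<close>, so their total length is at most \<open>(V b - V a) / M\<close>, which
  is small for large \<open>M\<close>.\<close>

lemma negligible_unbounded_slopes:
  assumes "a \<le> b" "variation_bound a b u V" "S \<subseteq> {a<..<b}"
    and steep: "\<And>t d M. \<lbrakk>t \<in> S; 0 < d; 0 < M\<rbrakk> \<Longrightarrow>
      \<exists>x y. x < y \<and> x \<le> t \<and> t \<le> y \<and> y - x < d \<and> M * (y - x) \<le> \<bar>u y - u x\<bar>"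
  shows "negligible S"
proof (rule negligible_if_fine_covers[where S = S and a = a and b = b])
  fix \<epsilon> :: real assume "0 < \<epsilon>"
  \<comment> \<open>The summand \<open>1\<close> keeps \<open>M\<close> positive when
    \<open>V b = V a\<close>.\<close>
  define M where "M = (V b - V a + 1) / \<epsilon>"
  have V_le: "V a \<le> V b" using variation_boundD(2)[OF assms(2)] \<open>a \<le> b\<close> by simp
  then have M: "0 < M" "V b - V a \<le> M * \<epsilon>"
    using \<open>0 < \<epsilon>\<close> by (auto simp: M_def field_simps)
  define K where "K = {(x, y). a \<le> x \<and> x < y \<and> y \<le> b \<and> M * (y - x) \<le> \<bar>u y - u x\<bar>}"
  have fine: "\<exists>(x, y)\<in>K. x \<le> t \<and> t \<le> y \<and> y - x < d" if t: "t \<in> S" "0 < d" for t d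
  proof -
    have "0 < min d (min (t - a) (b - t))"
      using t assms(3) by auto
    then obtain x y where "x < y" "x \<le> t" "t \<le> y" "y - x < min d (min (t - a) (b - t))"
        "M * (y - x) \<le> \<bar>u y - u x\<bar>"
      using steep[OF t(1) _ M(1)] by blast
    then show ?thesis by (intro bexI[of _ "(x, y)"]) (auto simp: K_def)
  qed
  have small: "(\<Sum>(x, y)\<in>P. y - x) \<le> \<epsilon>" if P: "P \<subseteq> K" "interval_family a b P" for P
  proof -
    have "M * (\<Sum>(x, y)\<in>P. y - x) = (\<Sum>(x, y)\<in>P. M * (y - x))"
      by (simp add: sum_distrib_left split_beta)
    also have "\<dots> \<le> (\<Sum>(x, y)\<in>P. \<bar>u y - u x\<bar>)"
      using P(1) by (intro sum_mono) (auto simp: K_def)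
    also have "\<dots> \<le> V b - V a"
      by (rule variation_bound_sum_le[OF P(2) \<open>a \<le> b\<close> assms(2)])
    finally have "M * (\<Sum>(x, y)\<in>P. y - x) \<le> M * \<epsilon>" using M(2) by linarith
    then show ?thesis using M(1) by simp
  qed
  show "\<exists>K N. negligible N \<and> (\<forall>(x, y)\<in>K. a \<le> x \<and> x < y \<and> y \<le> b) \<and>
      (\<forall>t\<in>S - N. \<forall>d>0. \<exists>(x, y)\<in>K. x \<le> t \<and> t \<le> y \<and> y - x < d) \<and>
      (\<forall>D\<subseteq>K. interval_family a b D \<longrightarrow> (\<Sum>(x, y)\<in>D. y - x) \<le> \<epsilon>)"
  proof (intro exI conjI)
    show "negligible {}" by simp
    show "\<forall>(x, y)\<in>K. a \<le> x \<and> x < y \<and> y \<le> b" by (auto simp: K_def)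
  qed (use fine small in blast)+
qed

section \<open>Classification of the points without a derivative\<close>

text \<open>If lower and upper limit of the difference quotient differ, two rationals separate them;
  if they agree, boundedness makes the common value finite and hence a derivative. Rational bounds
  are required so that only countably many exceptional sets arise.\<close>

lemma differentiable_or_oscillating_slopes:
  fixes u :: "real \<Rightarrow> real" and t :: real
  defines "\<phi> \<equiv> \<lambda>h. (u (t + h) - u t) / h"
  shows "(\<exists>D. (u has_real_derivative D) (at t)) \<or>
    (\<forall>M. \<exists>\<^sub>F h in at 0. M < \<bar>\<phi> h\<bar>) \<or>
    (\<exists>r\<in>\<rat>. \<exists>s\<in>\<rat>. r < s \<and> (\<exists>\<^sub>F h in at 0. \<phi> h < r) \<and> (\<exists>\<^sub>F h in at 0. s < \<phi> h))"
proof (rule disjCI)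
  assume "\<not> ((\<forall>M. \<exists>\<^sub>F h in at 0. M < \<bar>\<phi> h\<bar>) \<or>
    (\<exists>r\<in>\<rat>. \<exists>s\<in>\<rat>. r < s \<and> (\<exists>\<^sub>F h in at 0. \<phi> h < r) \<and> (\<exists>\<^sub>F h in at 0. s < \<phi> h)))"
  then obtain M where M: "\<forall>\<^sub>F h in at 0. \<bar>\<phi> h\<bar> \<le> M"
    and osc: "\<And>r s. \<lbrakk>r \<in> \<rat>; s \<in> \<rat>; r < s\<rbrakk> \<Longrightarrow> (\<forall>\<^sub>F h in at 0. r \<le> \<phi> h) \<or> (\<forall>\<^sub>F h in at 0. \<phi> h \<le> s)"
    unfolding de_Morgan_disj not_all frequently_def not_not not_less by blast
  define g where "g = (\<lambda>h. ereal (\<phi> h))"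
  let ?l = "Liminf (at 0) g" and ?L = "Limsup (at 0) g"
  have ne: "at (0::real) \<noteq> bot" by simp
  have "?l = ?L"
  proof (rule ccontr)
    assume "?l \<noteq> ?L"
    then have lt: "?l < ?L" using Liminf_le_Limsup[OF ne, of g] by simp
    \<comment> \<open>Two real values are inserted first, since the limits may be infinite and
      density of the rationals is applied between reals.\<close>
    obtain r' where r': "?l < ereal r'" "ereal r' < ?L" using lt ereal_dense2 by blast
    obtain s' where s': "ereal r' < ereal s'" "ereal s' < ?L" using r'(2) ereal_dense2 by blast
    then have "r' < s'" by simp
    obtain r where r: "r \<in> \<rat>" "r' < r" "r < s'" using Rats_dense_in_real \<open>r' < s'\<close> by blast
    obtain s where s: "s \<in> \<rat>" "r < s" "s < s'" using Rats_dense_in_real r(3) by blast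
    have "?l < ereal r" "ereal s < ?L"
      using r'(1) r(2) s'(2) s(3) by (meson less_ereal.simps(1) less_trans)+
    from osc[OF r(1) s(1,2)] show False
    proof
      assume "\<forall>\<^sub>F h in at 0. r \<le> \<phi> h"
      then have "ereal r \<le> ?l" by (intro Liminf_bounded) (simp add: g_def)
      with \<open>?l < ereal r\<close> show False by simp
    next
      assume "\<forall>\<^sub>F h in at 0. \<phi> h \<le> s"
      then have "?L \<le> ereal s" by (intro Limsup_bounded) (simp add: g_def)
      with \<open>ereal s < ?L\<close> show False by simp
    qed
  qed
  then have lim: "(g \<longlongrightarrow> ?l) (at 0)"
    using tendsto_Liminf[OF ne, of g] by simp
  have "ereal (- M) \<le> ?l"
    by (rule Liminf_bounded) (use M in eventually_elim, auto simp: g_def)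
  moreover have "?L \<le> ereal M"
    by (rule Limsup_bounded) (use M in eventually_elim, auto simp: g_def)
  ultimately obtain D where "?L = ereal D"
    using \<open>?l = ?L\<close> by (cases ?L) auto
  with lim \<open>?l = ?L\<close> have "(\<phi> \<longlongrightarrow> D) (at 0)" by (simp add: g_def)
  then show "\<exists>D. (u has_real_derivative D) (at t)"
    unfolding DERIV_def \<phi>_def by blast
qed

text \<open>Turns frequent behaviour of the difference quotient into covering intervals. The point
  \<open>t\<close> is the left or the right endpoint according to the sign of \<open>h\<close>, and
  the quotient is the same in both cases.\<close>

lemma short_interval_of_slope:
  fixes u :: "real \<Rightarrow> real"
  assumes "\<exists>\<^sub>F h in at 0. P ((u (t + h) - u t) / h)" "0 < d"
  shows "\<exists>x y. x < y \<and> x \<le> t \<and> t \<le> y \<and> y - x < d \<and> P ((u y - u x) / (y - x))"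
proof -
  have "\<forall>\<^sub>F h in at (0::real). h \<noteq> 0 \<and> \<bar>h\<bar> < d"
    using \<open>0 < d\<close> by (auto simp: eventually_at dist_real_def)
  then have "\<forall>\<^sub>F h in at 0. P ((u (t + h) - u t) / h) \<longrightarrow>
      P ((u (t + h) - u t) / h) \<and> h \<noteq> 0 \<and> \<bar>h\<bar> < d"
    by (rule eventually_mono) simp
  with assms(1) have "\<exists>\<^sub>F h in at 0. P ((u (t + h) - u t) / h) \<and> h \<noteq> 0 \<and> \<bar>h\<bar> < d"
    by (rule frequently_rev_mp)
  then obtain h where h: "P ((u (t + h) - u t) / h)" "h \<noteq> 0" "\<bar>h\<bar> < d"
    using frequently_ex by blast
  show ?thesis
  proof (cases "0 < h")
    case True
    then show ?thesis using h by (intro exI[of _ t] exI[of _ "t + h"]) auto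
  next
    case False
    moreover have "(u t - u (t + h)) / (t - (t + h)) = (u (t + h) - u t) / h"
      using h(2) by (simp add: field_simps)
    ultimately show ?thesis using h by (intro exI[of _ "t + h"] exI[of _ t]) auto
  qed
qed

text \<open>Allows a linear function to be subtracted, so that two different slopes become opposite
  ones.\<close>

lemma variation_bound_add_linear:
  assumes "variation_bound a b u V"
  shows "variation_bound a b (\<lambda>t. u t + k * t) (\<lambda>t. V t + \<bar>k\<bar> * t)"
  unfolding variation_bound_def
proof (intro allI impI)
  fix x y assume xy: "a \<le> x \<and> x \<le> y \<and> y \<le> b"
  have "\<bar>(u y + k * y) - (u x + k * x)\<bar> = \<bar>(u y - u x) + k * (y - x)\<bar>"
    by (simp add: algebra_simps)
  also have "\<dots> \<le> \<bar>u y - u x\<bar> + \<bar>k * (y - x)\<bar>"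
    by (rule abs_triangle_ineq)
  also have "\<bar>k * (y - x)\<bar> = \<bar>k\<bar> * (y - x)"
    using xy by (simp add: abs_mult)
  finally show "\<bar>(u y + k * y) - (u x + k * x)\<bar> \<le> (V y + \<bar>k\<bar> * y) - (V x + \<bar>k\<bar> * x)"
    using variation_boundD(1)[OF assms, of x y] xy by (simp add: algebra_simps)
qed

theorem variation_bound_differentiable_ae:
  assumes "a \<le> b" "variation_bound a b u V"
  shows "negligible {t\<in>{a<..<b}. \<not> (\<exists>D. (u has_real_derivative D) (at t))}"
proof -
  define \<phi> where "\<phi> t h = (u (t + h) - u t) / h" for t h
  define U where "U = {t\<in>{a<..<b}. \<forall>M. \<exists>\<^sub>F h in at 0. M < \<bar>\<phi> t h\<bar>}"
  define E where "E = (\<lambda>(r, s). {t\<in>{a<..<b}. (\<exists>\<^sub>F h in at 0. \<phi> t h < r) \<and> (\<exists>\<^sub>F h in at 0. s < \<phi> t h)})"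
  define Q where "Q = {(r, s). r \<in> \<rat> \<and> s \<in> \<rat> \<and> r < (s::real)}"
  have "negligible U"
  proof (rule negligible_unbounded_slopes[OF assms])
    show "U \<subseteq> {a<..<b}" by (auto simp: U_def)
    show "\<exists>x y. x < y \<and> x \<le> t \<and> t \<le> y \<and> y - x < d \<and> M * (y - x) \<le> \<bar>u y - u x\<bar>"
      if "t \<in> U" "0 < d" "0 < M" for t d M
    proof -
      have "\<exists>\<^sub>F h in at 0. M < \<bar>(u (t + h) - u t) / h\<bar>"
        using that(1) by (simp add: U_def \<phi>_def)
      from short_interval_of_slope[of "\<lambda>z. M < \<bar>z\<bar>", OF this that(2)]
      show ?thesis by (force simp: abs_divide field_simps)
    qed
  qed
  moreover have "negligible (E (r, s))" if "r < s" for r s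
  proof (rule negligible_opposite_slopes)
    \<comment> \<open>Subtracting the mean slope turns slopes above \<open>s\<close> and below
      \<open>r\<close> into slopes above \<open>(s - r) / 2\<close> and below
      \<open>- (s - r) / 2\<close>.\<close>
    define m where "m = (r + s) / 2"
    show "a \<le> b" by fact
    show "0 < (s - r) / 2" using that by simp
    show "variation_bound a b (\<lambda>t. u t + (- m) * t) (\<lambda>t. V t + \<bar>- m\<bar> * t)"
      by (rule variation_bound_add_linear[OF assms(2)])
    show "E (r, s) \<subseteq> {a<..<b}" by (auto simp: E_def)
    fix t d :: real assume t: "t \<in> E (r, s)" "0 < d"
    have "\<exists>\<^sub>F h in at 0. s < (u (t + h) - u t) / h" "\<exists>\<^sub>F h in at 0. (u (t + h) - u t) / h < r"
      using t(1) by (auto simp: E_def \<phi>_def)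
    note * = short_interval_of_slope[OF this(1) t(2)] short_interval_of_slope[OF this(2) t(2)]
    obtain x y where xy: "x < y" "x \<le> t" "t \<le> y" "y - x < d" "s < (u y - u x) / (y - x)"
      using *(1) by blast
    then have "s * (y - x) < u y - u x" by (simp add: field_simps)
    then have "(s - r) / 2 * (y - x) \<le> (u y + - m * y) - (u x + - m * x)"
      by (simp add: m_def field_simps)
    with xy show "\<exists>x y. x < y \<and> x \<le> t \<and> t \<le> y \<and> y - x < d \<and>
        (s - r) / 2 * (y - x) \<le> (u y + - m * y) - (u x + - m * x)" by blast
    obtain x y where xy: "x < y" "x \<le> t" "t \<le> y" "y - x < d" "(u y - u x) / (y - x) < r"
      using *(2) by blast
    then have "u y - u x < r * (y - x)" by (simp add: field_simps)
    then have "(u y + - m * y) - (u x + - m * x) \<le> - ((s - r) / 2) * (y - x)"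
      by (simp add: m_def field_simps)
    with xy show "\<exists>x y. x < y \<and> x \<le> t \<and> t \<le> y \<and> y - x < d \<and>
        (u y + - m * y) - (u x + - m * x) \<le> - ((s - r) / 2) * (y - x)" by blast
  qed
  moreover have "countable Q"
    by (rule countable_subset[of _ "\<rat> \<times> \<rat>"]) (auto simp: Q_def countable_rat)
  ultimately have "negligible (U \<union> (\<Union>i\<in>Q. E i))"
    by (intro negligible_Un negligible_countable_Union) (auto simp: Q_def)
  moreover have "{t\<in>{a<..<b}. \<not> (\<exists>D. (u has_real_derivative D) (at t))} \<subseteq> U \<union> (\<Union>i\<in>Q. E i)"
    using differentiable_or_oscillating_slopes[of u] unfolding U_def E_def Q_def \<phi>_def by blast
  ultimately show ?thesis by (rule negligible_subset)
qed

section \<open>Absolutely continuous functions\<close>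

lemma absolutely_continuous_fun_onD:
  assumes "absolutely_continuous_fun_on a b q" "0 < \<epsilon>"
  obtains \<delta> where "0 < \<delta>"
    and "\<And>D. \<lbrakk>interval_family a b D; (\<Sum>(x, y)\<in>D. y - x) < \<delta>\<rbrakk> \<Longrightarrow> (\<Sum>(x, y)\<in>D. \<bar>q y - q x\<bar>) < \<epsilon>"
  using assms unfolding absolutely_continuous_fun_on_def interval_family_def by meson

lemma absolutely_continuous_fun_onI:
  assumes "\<And>\<epsilon>. 0 < \<epsilon> \<Longrightarrow> \<exists>\<delta>>0. \<forall>D. interval_family a b D \<and> (\<Sum>(x, y)\<in>D. y - x) < \<delta> \<longrightarrow>
    (\<Sum>(x, y)\<in>D. \<bar>q y - q x\<bar>) < \<epsilon>"
  shows "absolutely_continuous_fun_on a b q"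
  using assms unfolding absolutely_continuous_fun_on_def interval_family_def by (simp add: conj_assoc)

lemma absolutely_continuous_fun_on_subinterval:
  assumes "absolutely_continuous_fun_on a b q" "a \<le> c" "d \<le> b"
  shows "absolutely_continuous_fun_on c d q"
proof (rule absolutely_continuous_fun_onI)
  fix \<epsilon> :: real assume "0 < \<epsilon>"
  from absolutely_continuous_fun_onD[OF assms(1) this] obtain \<delta> where "0 < \<delta>"
    and "\<And>D. \<lbrakk>interval_family a b D; (\<Sum>(x, y)\<in>D. y - x) < \<delta>\<rbrakk> \<Longrightarrow> (\<Sum>(x, y)\<in>D. \<bar>q y - q x\<bar>) < \<epsilon>"
    by blast
  with interval_family_mono[OF _ assms(2,3)]
  show "\<exists>\<delta>>0. \<forall>D. interval_family c d D \<and> (\<Sum>(x, y)\<in>D. y - x) < \<delta> \<longrightarrow> (\<Sum>(x, y)\<in>D. \<bar>q y - q x\<bar>) < \<epsilon>"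
    by blast
qed

text \<open>A Lipschitz outer function scales every variation sum by at most a constant. Absolute
  continuity of the outer function would not suffice.\<close>

lemma absolutely_continuous_fun_on_compose_lipschitz:
  assumes "absolutely_continuous_fun_on a b q" "q ` {a..b} \<subseteq> X"
    and lip: "\<And>x y. \<lbrakk>x \<in> X; y \<in> X\<rbrakk> \<Longrightarrow> \<bar>G y - G x\<bar> \<le> L * \<bar>y - x\<bar>"
  shows "absolutely_continuous_fun_on a b (\<lambda>t. G (q t))"
proof (rule absolutely_continuous_fun_onI)
  fix \<epsilon> :: real assume "0 < \<epsilon>"
  \<comment> \<open>The bound \<open>|L| + 1\<close> is positive whatever \<open>L\<close> is, so
    the division is harmless.\<close>
  then have "0 < \<epsilon> / (\<bar>L\<bar> + 1)" by simp
  from absolutely_continuous_fun_onD[OF assms(1) this] obtain \<delta> where "0 < \<delta>"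
    and \<delta>: "\<And>D. \<lbrakk>interval_family a b D; (\<Sum>(x, y)\<in>D. y - x) < \<delta>\<rbrakk> \<Longrightarrow>
      (\<Sum>(x, y)\<in>D. \<bar>q y - q x\<bar>) < \<epsilon> / (\<bar>L\<bar> + 1)"
    by blast
  have "(\<Sum>(x, y)\<in>D. \<bar>G (q y) - G (q x)\<bar>) < \<epsilon>"
    if D: "interval_family a b D" "(\<Sum>(x, y)\<in>D. y - x) < \<delta>" for D
  proof -
    have "(\<Sum>(x, y)\<in>D. \<bar>G (q y) - G (q x)\<bar>) \<le> (\<Sum>(x, y)\<in>D. (\<bar>L\<bar> + 1) * \<bar>q y - q x\<bar>)"
    proof (rule sum_mono, clarify)
      fix x y assume "(x, y) \<in> D"
      then have "q x \<in> X" "q y \<in> X"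
        using interval_familyD(2-4)[OF D(1), of x y] assms(2) by auto
      then have "\<bar>G (q y) - G (q x)\<bar> \<le> L * \<bar>q y - q x\<bar>" by (rule lip)
      also have "\<dots> \<le> (\<bar>L\<bar> + 1) * \<bar>q y - q x\<bar>"
        by (rule mult_right_mono) auto
      finally show "\<bar>G (q y) - G (q x)\<bar> \<le> (\<bar>L\<bar> + 1) * \<bar>q y - q x\<bar>" .
    qed
    also have "\<dots> = (\<bar>L\<bar> + 1) * (\<Sum>(x, y)\<in>D. \<bar>q y - q x\<bar>)"
      by (simp add: sum_distrib_left split_beta)
    also have "\<dots> < (\<bar>L\<bar> + 1) * (\<epsilon> / (\<bar>L\<bar> + 1))"
      using \<delta>[OF D] by (intro mult_strict_left_mono) auto
    finally show ?thesis by simp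
  qed
  with \<open>0 < \<delta>\<close> show "\<exists>\<delta>>0. \<forall>D. interval_family a b D \<and> (\<Sum>(x, y)\<in>D. y - x) < \<delta> \<longrightarrow>
      (\<Sum>(x, y)\<in>D. \<bar>G (q y) - G (q x)\<bar>) < \<epsilon>" by blast
qed

lemma absolutely_continuous_fun_on_imp_continuous_on:
  assumes "absolutely_continuous_fun_on a b q"
  shows "continuous_on {a..b} q"
  unfolding continuous_on_iff dist_real_def
proof (intro ballI allI impI)
  fix x \<epsilon> :: real assume x: "x \<in> {a..b}" and "0 < \<epsilon>"
  from absolutely_continuous_fun_onD[OF assms \<open>0 < \<epsilon>\<close>] obtain \<delta> where "0 < \<delta>"
    and \<delta>: "\<And>D. \<lbrakk>interval_family a b D; (\<Sum>(x, y)\<in>D. y - x) < \<delta>\<rbrakk> \<Longrightarrow> (\<Sum>(x, y)\<in>D. \<bar>q y - q x\<bar>) < \<epsilon>"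
    by blast
  have *: "\<bar>q z - q y\<bar> < \<epsilon>" if "a \<le> y" "y < z" "z \<le> b" "z - y < \<delta>" for y z
    using \<delta>[of "{(y, z)}"] that by (simp add: interval_family_iff)
  have "\<bar>q y - q x\<bar> < \<epsilon>" if "y \<in> {a..b}" "\<bar>y - x\<bar> < \<delta>" for y
    using *[of x y] *[of y x] that x \<open>0 < \<epsilon>\<close> by (cases x y rule: linorder_cases) auto
  with \<open>0 < \<delta>\<close> show "\<exists>d>0. \<forall>y\<in>{a..b}. \<bar>y - x\<bar> < d \<longrightarrow> \<bar>q y - q x\<bar> < \<epsilon>" by blast
qed

text \<open>On a piece shorter than the \<open>\<delta>\<close> belonging to \<open>1\<close>, every
  variation sum is below \<open>1\<close>; finitely many such pieces are glued together.\<close>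

lemma absolutely_continuous_fun_on_variation_bound:
  assumes "absolutely_continuous_fun_on a b q" "a \<le> b"
  obtains V where "variation_bound a b q V"
proof -
  from absolutely_continuous_fun_onD[OF assms(1) zero_less_one] obtain \<delta> where "0 < \<delta>"
    and \<delta>: "\<And>D. \<lbrakk>interval_family a b D; (\<Sum>(x, y)\<in>D. y - x) < \<delta>\<rbrakk> \<Longrightarrow> (\<Sum>(x, y)\<in>D. \<bar>q y - q x\<bar>) < 1"
    by blast
  have short: "\<exists>V. variation_bound x y q V" if "a \<le> x" "x \<le> y" "y \<le> b" "y - x < \<delta>" for x y
  proof -
    have "(\<Sum>(x, y)\<in>D. \<bar>q y - q x\<bar>) \<le> 1" if "interval_family x y D" for D
    proof -
      have "(\<Sum>(x, y)\<in>D. y - x) \<le> y - x"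
        using sum_increments_le[OF that \<open>x \<le> y\<close>, of "\<lambda>t. t"] by simp
      then show ?thesis
        using \<delta>[OF interval_family_mono[OF that]] \<open>a \<le> x\<close> \<open>y \<le> b\<close> \<open>y - x < \<delta>\<close> by force
    qed
    from variation_bound_of_sums[OF \<open>x \<le> y\<close> this] show ?thesis by blast
  qed
  \<comment> \<open>Pieces of length \<open>\<delta> / 2\<close> are used because
    \<open>short\<close> asks for a length strictly below \<open>\<delta>\<close>.\<close>
  have "\<exists>V. variation_bound a c q V" if "a \<le> c" "c \<le> b" "c - a \<le> real n * (\<delta> / 2)" for n c
    using that
  proof (induction n arbitrary: c)
    case 0
    then show ?case using short[of a c] \<open>0 < \<delta>\<close> by simp
  next
    case (Suc n)
    show ?case
    proof (cases "a \<le> c - \<delta> / 2")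
      case True
      have "\<exists>V. variation_bound a (c - \<delta> / 2) q V"
        using Suc True \<open>0 < \<delta>\<close> by (intro Suc.IH) (auto simp: algebra_simps)
      moreover have "\<exists>V. variation_bound (c - \<delta> / 2) c q V"
        using short[of "c - \<delta> / 2" c] Suc.prems True \<open>0 < \<delta>\<close> by simp
      ultimately show ?thesis
        using variation_bound_combine[of a "c - \<delta> / 2" q _ c] True \<open>0 < \<delta>\<close> by fastforce
    next
      case False
      then show ?thesis using short[of a c] Suc.prems \<open>0 < \<delta>\<close> by simp
    qed
  qed
  moreover obtain n where "(b - a) / (\<delta> / 2) \<le> real n"
    using real_arch_simple by blast
  then have "b - a \<le> real n * (\<delta> / 2)"
    using \<open>0 < \<delta>\<close> by (simp add: field_simps)
  ultimately show ?thesis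
    using that \<open>a \<le> b\<close> by blast
qed

section \<open>The integral of the derivative\<close>

text \<open>Carries sums over gauge divisions to interval families. Divisions may contain one-point
  intervals, even repeated under different indices; these are dropped, which is harmless when
  \<open>g x x = 0\<close>. Nondegenerate intervals with disjoint interiors are distinct, so
  reindexing by endpoints is injective.\<close>

lemma interval_family_of_nonoverlapping:
  fixes J :: "'i \<Rightarrow> real set"
  assumes "finite I"
    and J: "\<And>i. i \<in> I \<Longrightarrow> \<exists>x y. J i = {x..y} \<and> a \<le> x \<and> x \<le> y \<and> y \<le> b"
    and int: "\<And>i j. \<lbrakk>i \<in> I; j \<in> I; i \<noteq> j\<rbrakk> \<Longrightarrow> interior (J i) \<inter> interior (J j) = {}"
  obtains D where "interval_family a b D" "\<And>x y. (x, y) \<in> D \<Longrightarrow> {x..y} \<in> J ` I"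
    and "\<And>g :: real \<Rightarrow> real \<Rightarrow> real. (\<And>x. g x x = 0) \<Longrightarrow>
      (\<Sum>(x, y)\<in>D. g x y) = (\<Sum>i\<in>I. g (Inf (J i)) (Sup (J i)))"
proof -
  define e where "e i = (Inf (J i), Sup (J i))" for i
  define I' where "I' = {i\<in>I. Inf (J i) < Sup (J i)}"
  have Je: "J i = {Inf (J i)..Sup (J i)}" "a \<le> Inf (J i)" "Inf (J i) \<le> Sup (J i)" "Sup (J i) \<le> b"
    if i: "i \<in> I" for i
  proof -
    obtain x y where "J i = {x..y}" "a \<le> x" "x \<le> y" "y \<le> b" using J[OF i] by blast
    then show "J i = {Inf (J i)..Sup (J i)}" "a \<le> Inf (J i)" "Inf (J i) \<le> Sup (J i)" "Sup (J i) \<le> b"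
      by simp_all
  qed
  have disj: "{Inf (J i)<..<Sup (J i)} \<inter> {Inf (J j)<..<Sup (J j)} = {}" if "i \<in> I" "j \<in> I" "i \<noteq> j" for i j
    using int[OF that] arg_cong[OF Je(1)[OF that(1)], of interior] arg_cong[OF Je(1)[OF that(2)], of interior]
    by simp
  have inj: "inj_on e I'"
  proof (rule inj_onI, rule ccontr)
    fix i j assume "i \<in> I'" "j \<in> I'" "e i = e j" "i \<noteq> j"
    then show False using disj[of i j] by (auto simp: I'_def e_def)
  qed
  show ?thesis
  proof (rule that[of "e ` I'"])
    show "interval_family a b (e ` I')"
    proof (rule interval_familyI)
      fix x y x' y' assume "(x, y) \<in> e ` I'" "(x', y') \<in> e ` I'" "(x, y) \<noteq> (x', y')"
      then show "y \<le> x' \<or> y' \<le> x"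
        using disj disjoint_open_intervals_iff[of x y x' y'] by (auto simp: e_def I'_def)
    qed (use \<open>finite I\<close> Je in \<open>auto simp: e_def I'_def\<close>)
    show "{x..y} \<in> J ` I" if "(x, y) \<in> e ` I'" for x y
      using that Je(1) by (auto simp: e_def I'_def)
    show "(\<Sum>(x, y)\<in>e ` I'. g x y) = (\<Sum>i\<in>I. g (Inf (J i)) (Sup (J i)))"
      if g: "\<And>x. g x x = 0" for g :: "real \<Rightarrow> real \<Rightarrow> real"
    proof -
      have "(\<Sum>(x, y)\<in>e ` I'. g x y) = (\<Sum>i\<in>I'. g (Inf (J i)) (Sup (J i)))"
        unfolding sum.reindex[OF inj] by (simp add: e_def)
      also have "\<dots> = (\<Sum>i\<in>I. g (Inf (J i)) (Sup (J i)))"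
      proof (rule sum.mono_neutral_left)
        show "\<forall>i\<in>I - I'. g (Inf (J i)) (Sup (J i)) = 0"
          using Je(3) g by (force simp: I'_def)
      qed (use \<open>finite I\<close> in \<open>auto simp: I'_def\<close>)
      finally show ?thesis .
    qed
  qed
qed

lemma sum_lengths_le_measure:
  assumes "interval_family a b D" "\<And>x y. (x, y) \<in> D \<Longrightarrow> {x..y} \<subseteq> A" "A \<in> lmeasurable"
  shows "(\<Sum>(x, y)\<in>D. y - x) \<le> measure lebesgue A"
proof -
  let ?I = "\<lambda>i. {fst i<..<snd i}"
  have "(\<Sum>(x, y)\<in>D. y - x) = (\<Sum>i\<in>D. measure lebesgue (?I i))"
    using interval_familyD(3)[OF assms(1), THEN less_imp_le]
    by (intro sum.cong) (auto simp: split_beta)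
  also have "\<dots> = measure lebesgue (\<Union>i\<in>D. ?I i)"
    using assms(1) by (intro measure_finite_Union[symmetric])
      (auto simp: interval_family_def split_beta disjoint_family_on_def)
  also have "\<dots> \<le> measure lebesgue A"
  proof (rule measure_mono_fmeasurable)
    show "(\<Union>i\<in>D. ?I i) \<subseteq> A" using assms(2) by fastforce
    show "(\<Union>i\<in>D. ?I i) \<in> sets lebesgue"
      using interval_familyD(1)[OF assms(1)] by (intro sets.finite_UN) auto
  qed (use assms(3) in auto)
  finally show ?thesis .
qed

lemma negligible_outer_open:
  assumes "negligible (Z :: real set)" "0 < \<delta>"
  obtains A where "open A" "Z \<subseteq> A" "A \<in> lmeasurable" "measure lebesgue A < \<delta>"
proof -
  obtain A where A: "open A" "Z \<subseteq> A" "A - Z \<in> lmeasurable" "emeasure lebesgue (A - Z) < ennreal \<delta>"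
    using sets_lebesgue_outer_open[OF negligible_imp_sets[OF assms(1)] assms(2)] by blast
  have eq: "A = (A - Z) \<union> Z" using A(2) by blast
  have "A \<in> lmeasurable"
    by (subst eq, rule fmeasurable.Un[OF A(3) negligible_imp_measurable[OF assms(1)]])
  moreover have "measure lebesgue A = measure lebesgue (A - Z)"
  proof (rule measure_negligible_symdiff)
    show "A - Z \<in> lmeasurable" by (rule A(3))
    show "negligible (sym_diff (A - Z) A)"
      by (rule negligible_subset[OF assms(1)]) blast
  qed
  moreover have "measure lebesgue (A - Z) < \<delta>"
    using A(4) assms(2) by (simp add: emeasure_eq_measure2[OF A(3)] ennreal_less_iff)
  ultimately show ?thesis using that A by simp
qed

text \<open>The gauge separates two kinds of tags. At a tag outside \<open>Z\<close> the linear
  approximation controls the increment of \<open>w\<close>; intervals tagged in \<open>Z\<close> lie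
  in an open set of small measure, so absolute continuity makes their increments small in
  total.\<close>

theorem absolutely_continuous_fun_on_has_integral:
  assumes "a \<le> b" and ac: "absolutely_continuous_fun_on a b w" and "negligible Z"
    and deriv: "\<And>t. t \<in> {a..b} - Z \<Longrightarrow> (w has_real_derivative p t) (at t within {a..b})"
  shows "(p has_integral w b - w a) {a..b}"
proof -
  \<comment> \<open>Vanishing on \<open>Z\<close> removes the Riemann terms of the bad tags and
    leaves only the increments of \<open>w\<close> there.\<close>
  define p0 where "p0 t = (if t \<in> Z then 0 else p t)" for t
  have "(p0 has_integral w b - w a) {a..b}"
    unfolding has_integral_real
  proof (intro allI impI)
    fix \<epsilon> :: real assume "0 < \<epsilon>"
    then obtain \<delta> where "0 < \<delta>" and \<delta>: "\<And>D. \<lbrakk>interval_family a b D; (\<Sum>(x, y)\<in>D. y - x) < \<delta>\<rbrakk> \<Longrightarrow>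
        (\<Sum>(x, y)\<in>D. \<bar>w y - w x\<bar>) < \<epsilon> / 2"
      using absolutely_continuous_fun_onD[OF ac half_gt_zero] by blast
    obtain A where A: "open A" "Z \<subseteq> A" "A \<in> lmeasurable" "measure lebesgue A < \<delta>"
      using negligible_outer_open[OF \<open>negligible Z\<close> \<open>0 < \<delta>\<close>] .
    \<comment> \<open>The linear errors add up to \<open>\<eta> * (b - a)\<close>, at most half of
      \<open>\<epsilon>\<close>; the summand \<open>1\<close> covers \<open>a = b\<close>.\<close>
    define \<eta> where "\<eta> = \<epsilon> / (2 * (b - a + 1))"
    have \<eta>: "0 < \<eta>" "\<eta> * (b - a) \<le> \<epsilon> / 2"
      using \<open>0 < \<epsilon>\<close> \<open>a \<le> b\<close> by (auto simp: \<eta>_def field_simps)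
    have "\<exists>d>0. \<forall>y\<in>{a..b}. \<bar>y - t\<bar> < d \<longrightarrow> \<bar>w y - w t - p t * (y - t)\<bar> \<le> \<eta> * \<bar>y - t\<bar>"
      if "t \<in> {a..b} - Z" for t
      using deriv[OF that] \<eta>(1) unfolding has_field_derivative_def has_derivative_within_alt by simp
    then obtain d where d: "\<And>t. t \<in> {a..b} - Z \<Longrightarrow> 0 < d t"
      and dw: "\<And>t y. \<lbrakk>t \<in> {a..b} - Z; y \<in> {a..b}; \<bar>y - t\<bar> < d t\<rbrakk> \<Longrightarrow>
        \<bar>w y - w t - p t * (y - t)\<bar> \<le> \<eta> * \<bar>y - t\<bar>"
      by metis
    define \<gamma> where "\<gamma> t = (if t \<in> Z then A else if t \<in> {a..b} then ball t (d t) else UNIV)" for t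
    have gauge: "gauge \<gamma>"
      using A d by (auto simp: gauge_def \<gamma>_def)
    have est: "norm ((\<Sum>(t, k)\<in>\<D>. measure lborel k *\<^sub>R p0 t) - (w b - w a)) < \<epsilon>"
      if \<D>: "\<D> tagged_division_of {a..b}" "\<gamma> fine \<D>" for \<D>
    proof -
      note td = tagged_division_ofD[OF \<D>(1)]
      have k: "k = {Inf k..Sup k}" "a \<le> Inf k" "Inf k \<le> t" "t \<le> Sup k" "Sup k \<le> b"
          "measure lborel k = Sup k - Inf k" if tk: "(t, k) \<in> \<D>" for t k
      proof -
        obtain x y where xy: "k = {x..y}" using td(4)[OF tk] by auto
        then have "x \<le> t" "t \<le> y" "a \<le> x" "y \<le> b" using td(2,3)[OF tk] by auto
        with xy show "k = {Inf k..Sup k}" "a \<le> Inf k" "Inf k \<le> t" "t \<le> Sup k" "Sup k \<le> b"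
          "measure lborel k = Sup k - Inf k" by auto
      qed
      define \<D>1 where "\<D>1 = {i\<in>\<D>. fst i \<in> Z}"
      let ?R = "\<lambda>(t, k). measure lborel k * p0 t - (w (Sup k) - w (Inf k))"
      have fin: "finite \<D>" "finite \<D>1" "\<D>1 \<subseteq> \<D>" using td(1) by (auto simp: \<D>1_def)
      have "\<bar>\<Sum>i\<in>\<D>1. ?R i\<bar> < \<epsilon> / 2"
      proof -
        obtain D where D: "interval_family a b D" "\<And>x y. (x, y) \<in> D \<Longrightarrow> {x..y} \<in> snd ` \<D>1"
          and D_sum: "\<And>g :: real \<Rightarrow> real \<Rightarrow> real. (\<And>x. g x x = 0) \<Longrightarrow>
            (\<Sum>(x, y)\<in>D. g x y) = (\<Sum>i\<in>\<D>1. g (Inf (snd i)) (Sup (snd i)))"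
        proof (rule interval_family_of_nonoverlapping[of \<D>1 snd a b])
          show "\<exists>x y. snd i = {x..y} \<and> a \<le> x \<and> x \<le> y \<and> y \<le> b" if "i \<in> \<D>1" for i
            using k[of "fst i" "snd i"] that fin(3)
            by (intro exI[of _ "Inf (snd i)"] exI[of _ "Sup (snd i)"]) auto
          show "interior (snd i) \<inter> interior (snd j) = {}" if "i \<in> \<D>1" "j \<in> \<D>1" "i \<noteq> j" for i j
            using td(5)[of "fst i" "snd i" "fst j" "snd j"] that fin(3) by auto
        qed (use fin in auto)
        have "{x..y} \<subseteq> A" if xy: "(x, y) \<in> D" for x y
        proof -
          obtain t where t: "(t, {x..y}) \<in> \<D>" "t \<in> Z"
            using D(2)[OF xy] by (force simp: \<D>1_def)
          then have "{x..y} \<subseteq> \<gamma> t" using \<D>(2) by (auto simp: fine_def)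
          then show ?thesis using t(2) by (simp add: \<gamma>_def)
        qed
        from order.strict_trans1[OF sum_lengths_le_measure[OF D(1) this A(3)] A(4)]
        have "(\<Sum>(x, y)\<in>D. y - x) < \<delta>" .
        then have "(\<Sum>(x, y)\<in>D. \<bar>w y - w x\<bar>) < \<epsilon> / 2"
          by (rule \<delta>[OF D(1)])
        moreover have "(\<Sum>i\<in>\<D>1. \<bar>?R i\<bar>) = (\<Sum>(x, y)\<in>D. \<bar>w y - w x\<bar>)"
          unfolding D_sum[of "\<lambda>x y. \<bar>w y - w x\<bar>", simplified]
          by (intro sum.cong) (auto simp: \<D>1_def p0_def)
        ultimately show ?thesis
          using sum_abs[of ?R \<D>1] by linarith
      qed
      moreover have "\<bar>\<Sum>i\<in>\<D> - \<D>1. ?R i\<bar> \<le> \<epsilon> / 2"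
      proof -
        have "\<bar>?R i\<bar> \<le> \<eta> * measure lborel (snd i)" if "i \<in> \<D> - \<D>1" for i
        proof -
          obtain t l where i: "i = (t, l)" by (cases i)
          have tl: "(t, l) \<in> \<D>" "t \<notin> Z" using that i by (auto simp: \<D>1_def)
          note kt = k[OF tl(1)]
          have t: "t \<in> {a..b} - Z" using kt(2-5) tl(2) by auto
          have "l \<subseteq> \<gamma> t"
            using \<D>(2) tl(1) unfolding fine_def by blast
          then have "l \<subseteq> ball t (d t)"
            using t by (simp add: \<gamma>_def)
          moreover have "Inf l \<in> l" "Sup l \<in> l"
          proof -
            have "Inf l \<in> {Inf l..Sup l}" "Sup l \<in> {Inf l..Sup l}"
              using kt(2-5) by auto
            then show "Inf l \<in> l" "Sup l \<in> l"
              by (simp_all only: kt(1)[symmetric])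
          qed
          ultimately have "\<bar>Inf l - t\<bar> < d t" "\<bar>Sup l - t\<bar> < d t"
            by (auto simp: dist_real_def)
          then have "\<bar>w (Inf l) - w t - p t * (Inf l - t)\<bar> \<le> \<eta> * (t - Inf l)"
            "\<bar>w (Sup l) - w t - p t * (Sup l - t)\<bar> \<le> \<eta> * (Sup l - t)"
            using dw[OF t, of "Inf l"] dw[OF t, of "Sup l"] kt(2-5) by auto
          \<comment> \<open>The tag splits its interval; the errors on the two sides are bounded
            separately, and their bounds add up to \<open>\<eta>\<close> times the length of the
            interval.\<close>
          moreover have "?R i = (w (Inf l) - w t - p t * (Inf l - t)) - (w (Sup l) - w t - p t * (Sup l - t))"
            using tl(2) by (simp add: i p0_def kt(6) algebra_simps)
          moreover have "\<eta> * measure lborel (snd i) = \<eta> * (t - Inf l) + \<eta> * (Sup l - t)"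
            by (simp add: i kt(6) algebra_simps)
          ultimately show ?thesis by linarith
        qed
        then have "(\<Sum>i\<in>\<D> - \<D>1. \<bar>?R i\<bar>) \<le> (\<Sum>i\<in>\<D> - \<D>1. \<eta> * measure lborel (snd i))"
          by (rule sum_mono)
        also have "\<dots> \<le> (\<Sum>i\<in>\<D>. \<eta> * measure lborel (snd i))"
          using fin(1) \<eta>(1) by (intro sum_mono2) auto
        also have "\<dots> = \<eta> * (b - a)"
          using additive_content_tagged_division[of \<D> a b] \<D>(1) \<open>a \<le> b\<close>
          by (simp add: sum_distrib_left[symmetric] split_beta)
        also have "\<dots> \<le> \<epsilon> / 2" by (rule \<eta>(2))
        finally show ?thesis
          using sum_abs[of ?R "\<D> - \<D>1"] by linarith
      qed
      moreover have "(\<Sum>(t, k)\<in>\<D>. measure lborel k *\<^sub>R p0 t) - (w b - w a) = (\<Sum>i\<in>\<D>. ?R i)"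
        unfolding additive_tagged_division_1[OF \<open>a \<le> b\<close> \<D>(1), of w, symmetric]
        by (simp add: sum_subtractf split_beta)
      moreover have "(\<Sum>i\<in>\<D>. ?R i) = (\<Sum>i\<in>\<D> - \<D>1. ?R i) + (\<Sum>i\<in>\<D>1. ?R i)"
        using fin by (intro sum.subset_diff)
      ultimately show ?thesis
        unfolding real_norm_def by linarith
    qed
    show "\<exists>\<gamma>. gauge \<gamma> \<and> (\<forall>\<D>. \<D> tagged_division_of {a..b} \<and> \<gamma> fine \<D> \<longrightarrow>
        norm ((\<Sum>(t, k)\<in>\<D>. measure lborel k *\<^sub>R p0 t) - (w b - w a)) < \<epsilon>)"
      by (intro exI[of _ \<gamma>] conjI allI impI gauge) (elim conjE, rule est)
  qed
  then show ?thesis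
    by (rule has_integral_spike[OF \<open>negligible Z\<close>, rotated]) (simp add: p0_def)
qed

text \<open>The integral of \<open>p\<close> over a subinterval is the increment of
  \<open>w\<close>, so the sums of \<open>|integral K p|\<close> over divisions are bounded by the
  variation of \<open>w\<close>; for a gauge integrable function this is a criterion for absolute
  integrability.\<close>

lemma absolutely_continuous_fun_on_absolutely_integrable:
  assumes "a \<le> b" and ac: "absolutely_continuous_fun_on a b w" and "negligible Z"
    and deriv: "\<And>t. t \<in> {a..b} - Z \<Longrightarrow> (w has_real_derivative p t) (at t within {a..b})"
  shows "p absolutely_integrable_on {a..b}"
proof -
  obtain V where V: "variation_bound a b w V"
    using absolutely_continuous_fun_on_variation_bound[OF ac \<open>a \<le> b\<close>] .
  have "p absolutely_integrable_on cbox a b"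
  proof (rule bounded_variation_absolutely_integrable_interval)
    show "p integrable_on cbox a b"
      using absolutely_continuous_fun_on_has_integral[OF assms] by auto
    fix \<D> assume \<D>: "\<D> division_of cbox a b"
    note dd = division_ofD[OF \<D>]
    have K: "\<exists>x y. K = {x..y} \<and> a \<le> x \<and> x \<le> y \<and> y \<le> b" if KD: "K \<in> \<D>" for K
    proof -
      obtain x y where "K = {x..y}" using dd(4)[OF KD] by auto
      then show ?thesis using dd(2,3)[OF KD] by auto
    qed
    have int: "norm (integral K p) = \<bar>w (Sup K) - w (Inf K)\<bar>" if KD: "K \<in> \<D>" for K
    proof -
      obtain x y where xy: "K = {x..y}" "a \<le> x" "x \<le> y" "y \<le> b" using K[OF KD] by blast
      have "(p has_integral w y - w x) {x..y}"
      proof (rule absolutely_continuous_fun_on_has_integral[OF xy(3) _ \<open>negligible Z\<close>])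
        show "absolutely_continuous_fun_on x y w"
          by (rule absolutely_continuous_fun_on_subinterval[OF ac xy(2,4)])
        show "(w has_real_derivative p t) (at t within {x..y})" if "t \<in> {x..y} - Z" for t
          by (rule DERIV_subset[OF deriv]) (use that xy in auto)
      qed
      then show ?thesis using xy by (simp add: integral_unique)
    qed
    obtain D where D: "interval_family a b D" "\<And>x y. (x, y) \<in> D \<Longrightarrow> {x..y} \<in> (\<lambda>K. K) ` \<D>"
      and D_sum: "\<And>g :: real \<Rightarrow> real \<Rightarrow> real. (\<And>x. g x x = 0) \<Longrightarrow>
        (\<Sum>(x, y)\<in>D. g x y) = (\<Sum>K\<in>\<D>. g (Inf K) (Sup K))"
    proof (rule interval_family_of_nonoverlapping[of \<D> "\<lambda>K. K" a b])
      show "\<exists>x y. K = {x..y} \<and> a \<le> x \<and> x \<le> y \<and> y \<le> b" if "K \<in> \<D>" for K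
        by (rule K[OF that])
      show "interior K \<inter> interior L = {}" if "K \<in> \<D>" "L \<in> \<D>" "K \<noteq> L" for K L
        by (rule dd(5)[OF that])
    qed (use dd(1) in auto)
    have "(\<Sum>K\<in>\<D>. norm (integral K p)) = (\<Sum>(x, y)\<in>D. \<bar>w y - w x\<bar>)"
      using int D_sum[of "\<lambda>x y. \<bar>w y - w x\<bar>"] by simp
    also have "\<dots> \<le> V b - V a"
      by (rule variation_bound_sum_le[OF D(1) \<open>a \<le> b\<close> V])
    finally show "(\<Sum>K\<in>\<D>. norm (integral K p)) \<le> V b - V a" .
  qed
  then show ?thesis by simp
qed

section \<open>Substitution along an absolutely continuous function\<close>

text \<open>A primitive of \<open>k\<close> is Lipschitz with the bound of \<open>|k|\<close> as
  constant, so its composite with \<open>u\<close> is absolutely continuous and is recovered from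
  its derivative. Integrals start at the common left end \<open>c\<close> because integrals over
  \<open>{c..z}\<close> are not oriented.\<close>

lemma has_integral_substitution_continuous:
  fixes k u p :: "real \<Rightarrow> real"
  assumes "a \<le> b" and ac: "absolutely_continuous_fun_on a b u" and "negligible Z"
    and deriv: "\<And>t. t \<in> {a..b} - Z \<Longrightarrow> (u has_real_derivative p t) (at t within {a..b})"
    and range: "u ` {a..b} \<subseteq> {c..d}" and k: "continuous_on {c..d} k"
  shows "((\<lambda>t. k (u t) * p t) has_integral integral {c..u b} k - integral {c..u a} k) {a..b}"
proof (rule absolutely_continuous_fun_on_has_integral[OF \<open>a \<le> b\<close> _ \<open>negligible Z\<close>])
  obtain M where M: "\<And>x. x \<in> {c..d} \<Longrightarrow> norm (k x) \<le> M"
    using compact_imp_bounded[OF compact_continuous_image[OF k compact_Icc]]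
    unfolding bounded_iff by blast
  have le: "\<bar>integral {c..y} k - integral {c..x} k\<bar> \<le> M * \<bar>y - x\<bar>"
    if "c \<le> x" "x \<le> y" "y \<le> d" for x y
  proof -
    have "integral {c..x} k + integral {x..y} k = integral {c..y} k"
      using that by (intro Henstock_Kurzweil_Integration.integral_combine integrable_continuous_real
          continuous_on_subset[OF k]) auto
    moreover have "norm (integral {x..y} k) \<le> M * (y - x)"
      using that M by (intro integral_bound continuous_on_subset[OF k]) auto
    ultimately show ?thesis using that by simp
  qed
  show "absolutely_continuous_fun_on a b (\<lambda>t. integral {c..u t} k)"
  proof (rule absolutely_continuous_fun_on_compose_lipschitz[OF ac range])
    show "\<bar>integral {c..y} k - integral {c..x} k\<bar> \<le> M * \<bar>y - x\<bar>" if "x \<in> {c..d}" "y \<in> {c..d}" for x y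
      using le[of x y] le[of y x] that by (cases "x \<le> y") (auto simp: abs_minus_commute)
  qed
  fix t assume t: "t \<in> {a..b} - Z"
  then have "u t \<in> {c..d}" using range by (auto simp: image_subset_iff)
  then have "((\<lambda>z. integral {c..z} k) has_real_derivative k (u t)) (at (u t) within u ` {a..b})"
    by (rule DERIV_subset[OF integral_has_real_derivative[OF k] range])
  from DERIV_image_chain[OF this deriv[OF t]]
  show "((\<lambda>t. integral {c..u t} k) has_real_derivative k (u t) * p t) (at t within {a..b})"
    by (simp add: o_def)
qed

lemma has_integral_substitution_bounded:
  fixes g u p :: "real \<Rightarrow> real"
  assumes "a \<le> b" and ac: "absolutely_continuous_fun_on a b u" and "negligible Z"
    and deriv: "\<And>t. t \<in> {a..b} - Z \<Longrightarrow> (u has_real_derivative p t) (at t within {a..b})"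
    and range: "u ` {a..b} \<subseteq> {c..d}"
    and meas: "g \<in> borel_measurable (lebesgue_on {c..d})"
    and bounded: "\<And>x. x \<in> {c..d} \<Longrightarrow> \<bar>g x\<bar> \<le> M"
  shows "((\<lambda>t. g (u t) * p t) has_integral integral {c..u b} g - integral {c..u a} g) {a..b}"
proof -
  have "g measurable_on {c..d}"
    using meas by (simp add: measurable_on_iff_borel_measurable)
  then obtain N h where N: "negligible N" and h: "\<And>n. continuous_on UNIV (h n)"
    and h_lim: "\<And>x. x \<notin> N \<Longrightarrow> (\<lambda>n. h n x) \<longlonglongrightarrow> (if x \<in> {c..d} then g x else 0)"
    unfolding measurable_on_def by blast
  \<comment> \<open>The continuous approximants \<open>h n\<close> need not be bounded. Clamping
    them to the range of \<open>g\<close> keeps continuity and the limit, and supplies a dominating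
    constant.\<close>
  define k where "k n x = max (- M) (min M (h n x))" for n :: nat and x
  have ends: "u a \<in> {c..d}" "u b \<in> {c..d}"
    using range \<open>a \<le> b\<close> by (auto simp: image_subset_iff)
  have "0 \<le> M" using bounded[OF ends(1)] by linarith
  have k_cont: "continuous_on S (k n)" for n S
    unfolding k_def by (intro continuous_intros continuous_on_subset[OF h]) auto
  have k_le: "\<bar>k n x\<bar> \<le> M" for n x
    using \<open>0 \<le> M\<close> by (auto simp: k_def)
  have k_lim: "(\<lambda>n. k n x) \<longlonglongrightarrow> g x" if "x \<in> {c..d}" "x \<notin> N" for x
  proof -
    have "(\<lambda>n. k n x) \<longlonglongrightarrow> max (- M) (min M (g x))"
      unfolding k_def using h_lim[OF that(2)] that(1) by (intro tendsto_intros) simp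
    moreover have "max (- M) (min M (g x)) = g x"
      using bounded[OF that(1)] by auto
    ultimately show ?thesis by simp
  qed
  have G_lim: "(\<lambda>n. integral {c..z} (k n)) \<longlonglongrightarrow> integral {c..z} g" if z: "z \<in> {c..d}" for z
  proof -
    have "(\<lambda>n. integral {c..z} (\<lambda>x. if x \<in> N then 0 else k n x)) \<longlonglongrightarrow>
        integral {c..z} (\<lambda>x. if x \<in> N then 0 else g x)"
    proof (rule dominated_convergence(2)[where h = "\<lambda>_. M"])
      show "(\<lambda>x. if x \<in> N then 0 else k n x) integrable_on {c..z}" for n
        by (rule integrable_spike[OF integrable_continuous_real[OF k_cont] N]) simp
    qed (use k_le k_lim z \<open>0 \<le> M\<close> in auto)
    moreover have "integral {c..z} (\<lambda>x. if x \<in> N then 0 else k n x) = integral {c..z} (k n)" for n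
      by (rule integral_spike[OF N]) simp
    moreover have "integral {c..z} (\<lambda>x. if x \<in> N then 0 else g x) = integral {c..z} g"
      by (rule integral_spike[OF N]) simp
    ultimately show ?thesis by simp
  qed
  define R where "R = {t \<in> {a..b} - Z. p t \<noteq> 0}"
  \<comment> \<open>\<open>u\<close> can only stay in the exceptional set \<open>N\<close> with zero speed\<close>
  define Z' where "Z' = Z \<union> {t \<in> R. u t \<in> N}"
  \<comment> \<open>On \<open>R\<close> the derivative is multiplication by a nonzero number, hence
    injective, and preimages of null sets under such a map are null.\<close>
  have "negligible {t \<in> R. u t \<in> N}"
  proof (rule negligible_differentiable_vimage[OF N])
    fix t assume t: "t \<in> R"
    show "inj ((*) (p t))" using t by (auto simp: R_def inj_on_def)
    show "(u has_derivative (*) (p t)) (at t within R)"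
    proof (rule has_derivative_subset)
      show "(u has_derivative (*) (p t)) (at t within {a..b})"
        using deriv[of t] t by (simp add: R_def has_field_derivative_def)
      show "R \<subseteq> {a..b}" by (auto simp: R_def)
    qed
  qed
  then have Z': "negligible Z'" using \<open>negligible Z\<close> by (simp add: Z'_def)
  \<comment> \<open>Setting the speed to zero on \<open>Z'\<close> gives convergence at every point
    of \<open>{a..b}\<close>: either \<open>p' t = 0\<close> or \<open>u t\<close> avoids
    \<open>N\<close>.\<close>
  define p' where "p' t = (if t \<in> Z' then 0 else p t)" for t
  have deriv': "(u has_real_derivative p' t) (at t within {a..b})" if "t \<in> {a..b} - Z'" for t
  proof -
    have "t \<notin> Z'" "t \<in> {a..b} - Z" using that by (auto simp: Z'_def)
    then show ?thesis using deriv by (simp add: p'_def)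
  qed
  have int: "((\<lambda>t. k n (u t) * p' t) has_integral integral {c..u b} (k n) - integral {c..u a} (k n)) {a..b}" for n
    by (rule has_integral_substitution_continuous[OF \<open>a \<le> b\<close> ac Z' deriv' range k_cont])
  have p'_int: "p' absolutely_integrable_on {a..b}"
    by (rule absolutely_continuous_fun_on_absolutely_integrable[OF \<open>a \<le> b\<close> ac Z' deriv'])
  have lim: "(\<lambda>n. k n (u t) * p' t) \<longlonglongrightarrow> g (u t) * p' t" if "t \<in> {a..b}" for t
  proof (cases "p' t = 0")
    case False
    then have "u t \<notin> N" using that by (auto simp: p'_def Z'_def R_def split: if_splits)
    moreover have "u t \<in> {c..d}" using range that by (auto simp: image_subset_iff)
    ultimately show ?thesis by (intro tendsto_intros k_lim)
  qed simp
  have dom: "norm (k n (u t) * p' t) \<le> M * \<bar>p' t\<bar>" for n t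
    using k_le by (simp add: abs_mult mult_right_mono)
  have dom_int: "(\<lambda>t. M * \<bar>p' t\<bar>) integrable_on {a..b}"
    using p'_int integrable_cmul[of "\<lambda>t. \<bar>p' t\<bar>" "{a..b}" M]
    by (simp add: absolutely_integrable_on_def)
  have conv: "(\<lambda>t. g (u t) * p' t) integrable_on {a..b}"
    "(\<lambda>n. integral {a..b} (\<lambda>t. k n (u t) * p' t)) \<longlonglongrightarrow> integral {a..b} (\<lambda>t. g (u t) * p' t)"
    using dominated_convergence[where f = "\<lambda>n t. k n (u t) * p' t" and g = "\<lambda>t. g (u t) * p' t",
        OF has_integral_integrable[OF int] dom_int dom lim] by blast+
  have "(\<lambda>n. integral {a..b} (\<lambda>t. k n (u t) * p' t)) \<longlonglongrightarrow> integral {c..u b} g - integral {c..u a} g"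
    unfolding integral_unique[OF int] by (intro tendsto_diff G_lim ends)
  then have "integral {a..b} (\<lambda>t. g (u t) * p' t) = integral {c..u b} g - integral {c..u a} g"
    by (rule LIMSEQ_unique[OF conv(2)])
  then have "((\<lambda>t. g (u t) * p' t) has_integral integral {c..u b} g - integral {c..u a} g) {a..b}"
    using integrable_integral[OF conv(1)] by simp
  then show ?thesis
    by (rule has_integral_spike[OF Z', rotated]) (simp add: p'_def)
qed

text \<open>Clamping \<open>g\<close> at \<open>n\<close> never increases its absolute value, so
  \<open>|g|\<close> dominates on the side of the range and \<open>|g (u t) * p t|\<close> on the
  side of time. The latter has to be assumed integrable: integrability of \<open>g\<close> and
  absolute continuity of \<open>u\<close> do not imply it.\<close>

theorem has_integral_substitution_absolutely_continuous:
  fixes g u p :: "real \<Rightarrow> real"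
  assumes "a \<le> b" and ac: "absolutely_continuous_fun_on a b u" and "negligible Z"
    and deriv: "\<And>t. t \<in> {a..b} - Z \<Longrightarrow> (u has_real_derivative p t) (at t within {a..b})"
    and range: "u ` {a..b} \<subseteq> {c..d}"
    and g: "g absolutely_integrable_on {c..d}"
    and gu: "(\<lambda>t. g (u t) * p t) absolutely_integrable_on {a..b}"
  shows "((\<lambda>t. g (u t) * p t) has_integral integral {c..u b} g - integral {c..u a} g) {a..b}"
proof -
  define k where "k n x = max (- real n) (min (real n) (g x))" for n x
  have k_le: "\<bar>k n x\<bar> \<le> real n" "\<bar>k n x\<bar> \<le> \<bar>g x\<bar>" for n x
    by (auto simp: k_def)
  have k_lim: "(\<lambda>n. k n x) \<longlonglongrightarrow> g x" for x
  proof (rule tendsto_eventually)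
    obtain m where "\<bar>g x\<bar> \<le> real m" using real_arch_simple by blast
    then have "k n x = g x" if "m \<le> n" for n
      using that by (auto simp: k_def)
    then show "\<forall>\<^sub>F n in sequentially. k n x = g x"
      unfolding eventually_sequentially by blast
  qed
  have k_meas: "k n \<in> borel_measurable (lebesgue_on {c..d})" for n
  proof -
    have [measurable]: "g \<in> borel_measurable (lebesgue_on {c..d})"
      by (rule absolutely_integrable_imp_borel_measurable[OF g]) simp
    show ?thesis unfolding k_def by measurable
  qed
  have int: "((\<lambda>t. k n (u t) * p t) has_integral integral {c..u b} (k n) - integral {c..u a} (k n)) {a..b}" for n
    by (rule has_integral_substitution_bounded[OF \<open>a \<le> b\<close> ac \<open>negligible Z\<close> deriv range k_meas k_le(1)])
  have dom: "norm (k n (u t) * p t) \<le> \<bar>g (u t) * p t\<bar>" for n t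
    using k_le(2)[of n "u t"] by (simp add: abs_mult mult_right_mono)
  have dom_int: "(\<lambda>t. \<bar>g (u t) * p t\<bar>) integrable_on {a..b}"
    using gu by (simp add: absolutely_integrable_on_def)
  have lim: "(\<lambda>n. k n (u t) * p t) \<longlonglongrightarrow> g (u t) * p t" for t
    by (intro tendsto_intros k_lim)
  have conv: "(\<lambda>t. g (u t) * p t) integrable_on {a..b}"
    "(\<lambda>n. integral {a..b} (\<lambda>t. k n (u t) * p t)) \<longlonglongrightarrow> integral {a..b} (\<lambda>t. g (u t) * p t)"
    using dominated_convergence[where f = "\<lambda>n t. k n (u t) * p t" and g = "\<lambda>t. g (u t) * p t",
        OF has_integral_integrable[OF int] dom_int dom lim] by blast+
  have G_lim: "(\<lambda>n. integral {c..z} (k n)) \<longlonglongrightarrow> integral {c..z} g" if z: "z \<in> {c..d}" for z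
  proof (rule dominated_convergence(2)[where h = "\<lambda>x. \<bar>g x\<bar>"])
    have sub: "{c..z} \<subseteq> {c..d}" using z by auto
    have "(\<lambda>x. \<bar>g x\<bar>) integrable_on {c..d}" using g by (simp add: absolutely_integrable_on_def)
    then show *: "(\<lambda>x. \<bar>g x\<bar>) integrable_on {c..z}"
      by (rule integrable_on_subinterval[OF _ sub])
    show "k n integrable_on {c..z}" for n
    proof (rule measurable_bounded_by_integrable_imp_integrable[OF _ *])
      show "k n \<in> borel_measurable (lebesgue_on {c..z})"
        by (rule measurable_restrict_mono[OF k_meas sub])
    qed (use k_le(2) in auto)
  qed (use k_le(2) k_lim in auto)
  have ends: "u a \<in> {c..d}" "u b \<in> {c..d}"
    using range \<open>a \<le> b\<close> by (auto simp: image_subset_iff)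
  have "(\<lambda>n. integral {a..b} (\<lambda>t. k n (u t) * p t)) \<longlonglongrightarrow> integral {c..u b} g - integral {c..u a} g"
    unfolding integral_unique[OF int] by (intro tendsto_diff G_lim ends)
  then have "integral {a..b} (\<lambda>t. g (u t) * p t) = integral {c..u b} g - integral {c..u a} g"
    by (rule LIMSEQ_unique[OF conv(2)])
  then show ?thesis
    using integrable_integral[OF conv(1)] by simp
qed

section \<open>Cumulated impact and the price\<close>

text \<open>The executed quantity \<open>q0 - q t\<close> can have either sign, so the integrand is
  needed on both sides of \<open>0\<close>; reflection reduces the negative side to the positive
  one.\<close>

lemma absolutely_integrable_on_abs_argument:
  assumes "locally_integrable_on f {0..}"
  shows "(\<lambda>y. f \<bar>y\<bar>) absolutely_integrable_on {c..d}"
proof -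
  define m where "m = max \<bar>c\<bar> \<bar>d\<bar>"
  have "0 \<le> m" by (simp add: m_def)
  have f: "f absolutely_integrable_on {0..m}"
    using assms unfolding locally_integrable_on_def by auto
  have "(\<lambda>y. f \<bar>y\<bar>) absolutely_integrable_on {0..m}"
    using f by (subst set_integrable_cong[OF refl refl, of _ _ f]) auto
  \<comment> \<open>The endpoint is written \<open>-0\<close> to match the reflection rule
    literally.\<close>
  moreover have "(\<lambda>y. f (- y)) absolutely_integrable_on {-m..-0}"
    using f by (simp only: absolutely_integrable_reflect_real)
  then have "(\<lambda>y. f \<bar>y\<bar>) absolutely_integrable_on {-m..0}"
    by (subst set_integrable_cong[OF refl refl, of _ _ "\<lambda>y. f (- y)"]) auto
  ultimately have "(\<lambda>y. f \<bar>y\<bar>) absolutely_integrable_on ({0..m} \<union> {-m..0})"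
    by (rule absolutely_integrable_Un)
  then show ?thesis
    by (rule set_integrable_subset) (auto simp: m_def)
qed

text \<open>Relates the oriented integral to unoriented ones with a common base point
  \<open>c\<close>, the form in which the substitution rule is stated; the sign of \<open>z\<close>
  decides which interval is split.\<close>

lemma cumulated_impact_eq:
  assumes "locally_integrable_on f {0..}" "c \<le> 0" "c \<le> z"
  shows "cumulated_impact f z = integral {c..z} (\<lambda>y. f \<bar>y\<bar>) - integral {c..0} (\<lambda>y. f \<bar>y\<bar>)"
proof -
  let ?g = "\<lambda>y. f \<bar>y\<bar>"
  have g: "?g absolutely_integrable_on {x..y}" for x y
    by (rule absolutely_integrable_on_abs_argument[OF assms(1)])
  have g_int: "?g integrable_on {x..y}" for x y
    using g by (simp add: absolutely_integrable_on_def)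
  \<comment> \<open>The oriented integral is defined through open intervals; the endpoints do not
    affect the value.\<close>
  have eq: "(LINT y:{x<..<y}|lebesgue. ?g y) = integral {x..y} ?g" for x y
  proof -
    have "?g absolutely_integrable_on {x<..<y}"
      by (rule set_integrable_subset[OF g[of x y]]) auto
    then show ?thesis
      by (simp add: set_lebesgue_integral_eq_integral integral_open_interval_real)
  qed
  show ?thesis
  proof (cases "0 \<le> z")
    case True
    then have "integral {c..0} ?g + integral {0..z} ?g = integral {c..z} ?g"
      by (intro Henstock_Kurzweil_Integration.integral_combine assms(2) g_int)
    with True show ?thesis
      by (simp add: cumulated_impact_def interval_lebesgue_integral_def zero_ereal_def eq)
  next
    case False
    then have "integral {c..z} ?g + integral {z..0} ?g = integral {c..0} ?g"
      by (intro Henstock_Kurzweil_Integration.integral_combine assms(3) g_int) auto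
    with False show ?thesis
      by (simp add: cumulated_impact_def interval_lebesgue_integral_def zero_ereal_def eq)
  qed
qed

theorem proposition3:
  fixes M :: "'a measure" and \<F> :: "real \<Rightarrow> 'a measure"
    and W S :: "real \<Rightarrow> 'a \<Rightarrow> real"
    and f q v :: "real \<Rightarrow> real" and T q0 \<sigma> :: real
  assumes space: "usual_filtered_prob_space M \<F>"
    and W: "standard_brownian_motion M \<F> W"
    and T: "T > 0"
    and f_pos: "AE y in lebesgue. 0 \<le> y \<longrightarrow> f y > 0"
    and f_loc: "locally_integrable_on f {0..}"
    and q_ac: "absolutely_continuous_fun_on 0 T q"
    and v: "AE t in lebesgue. t \<in> {0..T} \<longrightarrow> v t = - deriv q t"
    and v_after: "\<And>t. t > T \<Longrightarrow> v t = 0"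
    and S: "has_stochastic_differential M \<F> S \<sigma> W (\<lambda>t. - f \<bar>q0 - q t\<bar> * v t)"
    and q_init: "q 0 = q0"
    and q_end: "q T = 0"
  shows "AE \<omega> in M. \<forall>T'\<ge>T. S T' \<omega> - S 0 \<omega> = - cumulated_impact f q0 + \<sigma> * W T' \<omega>"
proof -
  define u where "u t = q0 - q t" for t
  define b where "b t = - f \<bar>q0 - q t\<bar> * v t" for t
  have b_int: "b absolutely_integrable_on {0..t}" if "0 \<le> t" for t
    using S that unfolding has_stochastic_differential_def b_def by blast
  have u_ac: "absolutely_continuous_fun_on 0 T u"
    unfolding u_def
    by (rule absolutely_continuous_fun_on_compose_lipschitz[OF q_ac subset_UNIV, where L = 1]) auto
  obtain V where "variation_bound 0 T q V"
    using absolutely_continuous_fun_on_variation_bound[OF q_ac] T by auto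
  from variation_bound_differentiable_ae[OF _ this] T
  have nondiff: "negligible {t\<in>{0<..<T}. \<not> (\<exists>D. (q has_real_derivative D) (at t))}" by simp
  obtain N where N: "negligible N" "\<And>t. \<lbrakk>t \<in> {0..T}; t \<notin> N\<rbrakk> \<Longrightarrow> v t = - deriv q t"
    using v unfolding eventually_ae_filter negligible_iff_null_sets by auto
  \<comment> \<open>The endpoints \<open>0\<close> and \<open>T\<close> are added because
    \<open>deriv\<close> is two-sided, while \<open>q\<close> is controlled only on
    \<open>{0..T}\<close>.\<close>
  define Z where "Z = {t\<in>{0<..<T}. \<not> (\<exists>D. (q has_real_derivative D) (at t))} \<union> N \<union> {0, T}"
  have Z: "negligible Z"
    using nondiff N(1) by (simp add: Z_def)
  have deriv: "(u has_real_derivative v t) (at t within {0..T})" if t: "t \<in> {0..T} - Z" for t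
  proof -
    have "t \<in> {0<..<T}" using t by (auto simp: Z_def)
    then obtain D where "(q has_real_derivative D) (at t)"
      using t by (auto simp: Z_def)
    then have "(q has_real_derivative deriv q t) (at t)"
      using DERIV_imp_deriv by blast
    then have "(u has_real_derivative - deriv q t) (at t)"
      unfolding u_def by (auto intro!: derivative_eq_intros)
    then show ?thesis
      using N(2)[of t] t by (auto simp: Z_def intro: DERIV_subset)
  qed
  \<comment> \<open>The strategy need not be monotone, so \<open>u\<close> may leave the interval
    between \<open>0\<close> and \<open>q0\<close>; a range that contains all its values is taken
    instead.\<close>
  have "compact (u ` {0..T})"
    using absolutely_continuous_fun_on_imp_continuous_on[OF u_ac]
    by (intro compact_continuous_image) auto
  then obtain c d where range: "u ` {0..T} \<subseteq> {c..d}"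
    using bounded_subset_cbox_symmetric[OF compact_imp_bounded] by (metis cbox_interval)
  have u_ends: "u 0 = 0" "u T = q0" by (auto simp: u_def q_init q_end)
  then have c: "c \<le> 0" "c \<le> q0"
    using range T by (force simp: image_subset_iff)+
  have gu: "(\<lambda>t. f \<bar>u t\<bar> * v t) = (\<lambda>t. - b t)"
    by (auto simp: u_def b_def)
  \<comment> \<open>The integrability required by the substitution rule is part of the meaning of
    the stochastic differential.\<close>
  have "(\<lambda>t. - b t) absolutely_integrable_on {0..T}"
    using b_int[of T] T by (simp add: set_integrable_def)
  then have "((\<lambda>t. f \<bar>u t\<bar> * v t) has_integral
      integral {c..u T} (\<lambda>y. f \<bar>y\<bar>) - integral {c..u 0} (\<lambda>y. f \<bar>y\<bar>)) {0..T}"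
    using has_integral_substitution_absolutely_continuous[OF less_imp_le[OF T] u_ac Z deriv range
        absolutely_integrable_on_abs_argument[OF f_loc]] by (simp add: gu)
  then have "((\<lambda>t. - b t) has_integral cumulated_impact f q0) {0..T}"
    by (simp add: gu u_ends cumulated_impact_eq[OF f_loc c])
  then have b_T: "integral {0..T} b = - cumulated_impact f q0"
    by (simp add: has_integral_neg_iff integral_unique)
  have b_T': "(LINT s:{0..T'}|lebesgue. b s) = - cumulated_impact f q0" if "T \<le> T'" for T'
  proof -
    have int: "b absolutely_integrable_on {0..T'}" using b_int[of T'] that T by simp
    \<comment> \<open>The speed is known to vanish only strictly after \<open>T\<close>, so the
      point \<open>T\<close> itself is removed as a null set.\<close>
    have "integral {T..T'} b = integral {T..T'} (\<lambda>_. 0)"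
      by (rule integral_spike[of "{T}"]) (auto simp: b_def v_after)
    moreover have "integral {0..T} b + integral {T..T'} b = integral {0..T'} b"
      using int that T
      by (intro Henstock_Kurzweil_Integration.integral_combine) (auto simp: absolutely_integrable_on_def)
    ultimately show ?thesis
      by (simp add: set_lebesgue_integral_eq_integral[OF int] b_T)
  qed
  \<comment> \<open>\<open>W\<close> starts at \<open>0\<close> only almost surely. This null set
    and the one of the price equation do not depend on \<open>T'\<close>, so the identity holds for
    all \<open>T'\<close> at once.\<close>
  have "AE \<omega> in M. W 0 \<omega> = 0"
    using W unfolding standard_brownian_motion_def by blast
  moreover have "AE \<omega> in M. \<forall>t\<ge>0. S t \<omega> = S 0 \<omega> + \<sigma> * (W t \<omega> - W 0 \<omega>) + (LINT s:{0..t}|lebesgue. b s)"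
    using S unfolding has_stochastic_differential_def b_def by blast
  ultimately show ?thesis
  proof eventually_elim
    case (elim \<omega>)
    show ?case
    proof (intro allI impI)
      fix T' assume "T \<le> T'"
      with elim(1) elim(2)[rule_format, of T'] T show "S T' \<omega> - S 0 \<omega> = - cumulated_impact f q0 + \<sigma> * W T' \<omega>"
        by (simp add: b_T')
    qed
  qed
qed

end
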